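(* Let $\Bbbk$ be a field, let $\mathcal{A}$ be an essential arrangement of $n+1$ distinct hyperplanes in an $(r+1)$-dimensional $\Bbbk$-vector space $L$, with chosen defining linear forms $x_0,\ldots,x_n$ embedding $L$ in $\Bbbk^{n+1}$, let $M$ be the matroid of $\mathcal{A}$ on $\{0,\ldots,n\}$ with rank function $\operatorname{rk}$, and let $\Gamma_{\mathcal{A}}\subseteq\mathbb{P}^n\times\mathbb{P}^n$ be the reciprocal graph. Let $S=\Bbbk[x_0,\ldots,x_n,y_0,\ldots,y_n]$ be the bihomogeneous coordinate ring of $\mathbb{P}^n\times\mathbb{P}^n$. Fix a total order $\prec$ on $\{0,\ldots,n\}$, and write $i{\uparrow}=\{j\in\{0,\ldots,n\}\mid i\preceq j\}$. Let $>$ be a (total) term order on $S$ such that $x_i>x_j$ if $i\prec j$, such that $y_i>y_j$ if $i>j$ (in the natural order on integers), and such that, for every integer $a\ge 1$, any term that is a multiple of $y_0^a$ is less than any term of the same degree that is not. Then: (1) The defining ideal $I(\Gamma_{\mathcal{A}})\subseteq S$ is generated by the following elements: - $\sum_{i\in\mathcal{C}} a_i x_i$, where $\mathcal{C}$ is a circuit of $M$ and the $a_i=a_i(\mathcal{C})\in\Bbbk$ are the coefficients of the linear relation $\sum_{i\in\mathcal{C}}a_ix_i=0$ on $L$ given by the circuit; - $\sum_{i\in\mathcal{C}} a_i\prod_{j\in\mathcal{C}\setminus\{i\}} y_j$, where $\mathcal{C}$ is a circuit of $M$ and the $a_i$ are the same coefficients; - $x_iy_i-x_0y_0$, for all $i$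 with $1\le i\le n$. (2) The initial ideal $\operatorname{init} I(\Gamma_{\mathcal{A}})\subseteq S$ with respect to $>$ is generated by the following elements: - $\prod_{i\in\mathcal{B}} y_i$, where $\mathcal{B}$ is a broken circuit of $M$; - $x_j\prod_{i\in I} y_i$, where $j\in\{0,\ldots,n\}$ and $I$ is any subset of $\{1,\ldots,n\}$ (so not including $0$) such that $\operatorname{rk}(j{\uparrow}\cup I)=\operatorname{rk}((j{\uparrow}\setminus\{j\})\cup I)$ (this includes the degenerate case where $j\in I$). (3) The initial ideal $\operatorname{init} I(\Gamma_{\mathcal{A}})$ is the Stanley–Reisner ideal $I(\Delta^{\mathrm{ENBC}}_{M,\prec})$ of the extended no broken circuit complex $\Delta^{\mathrm{ENBC}}_{M,\prec}$.
   Context: **Arrangement.** $\Bbbk$ is a field and $\mathcal{A}$ is an arrangement of $n+1$ distinct (linear) hyperplanes in an $(r+1)$-dimensional $\Bbbk$-vector space $L$. It is assumed essential: the intersection of all the hyperplanes is $\{0\}$. For each $i\in\{0,\ldots,n\}$ fix a linear form $x_i$ on $L$ whose zero set is the $i$-th hyperplane. These forms give an injective linear map $L\to\Bbbk^{n+1}$, by which $L$ is identified with its image. Then $\widetilde{L}\subseteq L$ denotes the complement of the coordinate hyperplanes $x_i=0$, and $\mathbb{P}(\widetilde{L})\subseteq\mathbb{P}^n$ its projectivization. **Matroid.** $M$ is the matroid of rank $r+1$ on $\{0,\ldots,n\}$ in which a set $\mathcal{C}$ is dependent if and only if the linear forms $\{x_i\mid i\in\mathcal{C}\}$ on $L$ are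 linearly dependent; $\operatorname{rk}$ is its rank function. A circuit is a minimal dependent set. Each circuit $\mathcal{C}$ gives a linear relation $\sum_{i\in\mathcal{C}}a_ix_i=0$ on $L$, unique up to scalar, with all $a_i\neq0$. **Reciprocal graph.** The Cremona transformation $\mathbb{P}^n\dashrightarrow\mathbb{P}^n$ sends $(z_0:\cdots:z_n)$ to $(z_0^{-1}:\cdots:z_n^{-1})$. The reciprocal graph $\Gamma_{\mathcal{A}}$ is the closure in $\mathbb{P}^n\times\mathbb{P}^n$ of the graph of the Cremona transformation restricted to $\mathbb{P}(\widetilde{L})$. Here varieties are understood as schemes over $\Bbbk$ (so $\mathbb{P}(\widetilde{L})$ is a nonempty open subscheme of $\mathbb{P}(L)$ even if $\Bbbk$ is finite). In $S$ the $x_i$ are the homogeneous coordinates on the first factor and the $y_i$ those on the second, and $I(\Gamma_{\mathcal{A}})\subseteq S$ is the ideal generated by all bihomogeneous polynomials vanishing on $\Gamma_{\mathcal{A}}$. **Initial ideals.** For nonzero $f\in S$, $\operatorname{init} f$ is the largest monomial in the support of $f$ for the term order. For an ideal $I\subseteq S$, $\operatorname{init} I$ is the monomial ideal generated by $\operatorname{init} f$ for nonzero $f\in I$. **No broken circuit complexes.** A broken circuit is the result of deleting the least element (in the natural order $0<1<\cdots<n$) from a circuit of $M$. The no broken circuit complex $\Delta^{\mathrm{NBC}}_M$ is the simplicial complex on $\{0,\ldots,n\}$ whose faces are the subsets containing no broken circuit. The vertex $0$ is a cone point of it, and the reduced no broken circuit complex $\Delta^{\mathrm{RNBC}}_M$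 is obtained by deleting the vertex $0$; that is, its faces are the subsets of $\{1,\ldots,n\}$ containing no broken circuit (including $\emptyset$). **Extended no broken circuit complex.** For $F\in\Delta^{\mathrm{RNBC}}_M$, let $L(F)$ be the basis of $M$ containing $F$ that is lexicographically maximal with respect to $\prec$; precisely, $i\in L(F)$ if and only if $i\in F$ or $\operatorname{rk}(i{\uparrow}\cup F)>\operatorname{rk}((i{\uparrow}\setminus\{i\})\cup F)$, where $i{\uparrow}=\{j\mid i\preceq j\}$. Define $$\overline{F}=\{y_i\mid i\in F\}\cup\{x_j\mid j\in L(F)\setminus F\}\cup\{y_0\}.$$ Then $\Delta^{\mathrm{ENBC}}_{M,\prec}$ is the simplicial complex on the $2(n+1)$ vertices $\{x_0,\ldots,x_n,y_0,\ldots,y_n\}$ given by $$\Delta^{\mathrm{ENBC}}_{M,\prec}=\{G\mid G\subseteq\overline{F}\text{ for some }F\in\Delta^{\mathrm{RNBC}}_M\}.$$ **Stanley–Reisner ideal.** For a simplicial complex $\Delta$ on $\{x_0,\ldots,x_n,y_0,\ldots,y_n\}$, $I(\Delta)\subseteq S$ is the squarefree monomial ideal generated by $\prod_{v\in A}v$ for all subsets $A$ of the vertex set with $A\notin\Delta$. *)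

theory Defs
  imports "HOL-Library.Poly_Mapping" "HOL-Algebra.Ideal" "HOL-Algebra.Algebraic_Closure_Type"
begin

section \<open>The matroid of a family of linear forms\<close>

text \<open>The ground set is \<open>{..n}\<close>, that is, \<open>{0, \<dots>, n}\<close>.  Linear independence is that of the
  indexed family \<open>(x i)\<close>, \<open>i \<in> C\<close>, in the dual space; it is used for finite \<open>C\<close> only.\<close>

definition independent_forms :: "(nat \<Rightarrow> 'v \<Rightarrow> 'k::field) \<Rightarrow> nat set \<Rightarrow> bool" where
  "independent_forms x C \<longleftrightarrow>
     (\<forall>a. (\<forall>v. (\<Sum>i\<in>C. a i * x i v) = 0) \<longrightarrow> (\<forall>i\<in>C. a i = 0))"

definition rk :: "(nat \<Rightarrow> 'v \<Rightarrow> 'k::field) \<Rightarrow> nat set \<Rightarrow> nat" where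
  "rk x A = Max {card B | B. B \<subseteq> A \<and> independent_forms x B}"

definition matroid_circuit :: "nat \<Rightarrow> (nat \<Rightarrow> 'v \<Rightarrow> 'k::field) \<Rightarrow> nat set \<Rightarrow> bool" where
  "matroid_circuit n x C \<longleftrightarrow>
     C \<subseteq> {..n} \<and> \<not> independent_forms x C \<and> (\<forall>D. D \<subset> C \<longrightarrow> independent_forms x D)"

definition circuit_relation ::
    "(nat \<Rightarrow> 'v \<Rightarrow> 'k::field) \<Rightarrow> nat set \<Rightarrow> (nat \<Rightarrow> 'k) \<Rightarrow> bool" where
  "circuit_relation x C a \<longleftrightarrow> (\<forall>i\<in>C. a i \<noteq> 0) \<and> (\<forall>v. (\<Sum>i\<in>C. a i * x i v) = 0)"

definition broken_circuit :: "nat \<Rightarrow> (nat \<Rightarrow> 'v \<Rightarrow> 'k::field) \<Rightarrow> nat set \<Rightarrow> bool" where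
  "broken_circuit n x B \<longleftrightarrow> (\<exists>C. matroid_circuit n x C \<and> B = C - {Min C})"


section \<open>The bihomogeneous coordinate ring\<close>

datatype var = XVar nat | YVar nat

text \<open>A term is the exponent vector of a monomial; multiplication of monomials is addition of
  exponent vectors, and the monomial \<open>1\<close> is the exponent vector \<open>0\<close>.\<close>

type_synonym monomial = "var \<Rightarrow>\<^sub>0 nat"
type_synonym 'k bipoly = "monomial \<Rightarrow>\<^sub>0 'k"

definition bivars :: "nat \<Rightarrow> var set" where
  "bivars n = XVar ` {..n} \<union> YVar ` {..n}"

definition monomials :: "nat \<Rightarrow> monomial set" where
  "monomials n = {m. Poly_Mapping.keys m \<subseteq> bivars n}"

definition coord_ring :: "nat \<Rightarrow> ('k::field bipoly) ring" where
  "coord_ring n = \<lparr>carrier = {f. Poly_Mapping.keys f \<subseteq> monomials n},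
     monoid.mult = (*), one = 1, zero = 0, add = (+)\<rparr>"

definition pterm :: "monomial \<Rightarrow> 'k::field bipoly" where
  "pterm m = Poly_Mapping.single m 1"

definition pconst :: "'k::field \<Rightarrow> 'k bipoly" where
  "pconst c = Poly_Mapping.single 0 c"

definition mvar :: "var \<Rightarrow> monomial" where
  "mvar v = Poly_Mapping.single v 1"

definition pvar :: "var \<Rightarrow> 'k::field bipoly" where
  "pvar v = pterm (mvar v)"

abbreviation px :: "nat \<Rightarrow> 'k::field bipoly" where "px i \<equiv> pvar (XVar i)"
abbreviation py :: "nat \<Rightarrow> 'k::field bipoly" where "py i \<equiv> pvar (YVar i)"

definition mdegree :: "monomial \<Rightarrow> nat" where
  "mdegree m = (\<Sum>v\<in>Poly_Mapping.keys m. Poly_Mapping.lookup m v)"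

definition bihomogeneous :: "nat \<Rightarrow> 'k::field bipoly \<Rightarrow> bool" where
  "bihomogeneous n f \<longleftrightarrow> f \<in> carrier (coord_ring n) \<and>
     (\<exists>d e. \<forall>m\<in>Poly_Mapping.keys f. (\<Sum>i\<le>n. Poly_Mapping.lookup m (XVar i)) = d \<and> (\<Sum>i\<le>n. Poly_Mapping.lookup m (YVar i)) = e)"

lemma monomials_0: "0 \<in> monomials n"
  by (simp add: monomials_def)

lemma monomials_add: "s \<in> monomials n \<Longrightarrow> t \<in> monomials n \<Longrightarrow> s + t \<in> monomials n"
  using Poly_Mapping.keys_add[of s t] by (auto simp: monomials_def)

lemma cring_coord_ring: "cring (coord_ring n :: ('k::field bipoly) ring)"
proof (intro cringI abelian_groupI comm_monoidI, goal_cases)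
  case (1 f g)
  then show ?case using Poly_Mapping.keys_add[of f g] by (auto simp: coord_ring_def)
next
  case (6 f)
  then show ?case
    by (intro bexI[of _ "- f"]) (auto simp: coord_ring_def)
next
  case (7 f g)
  then have "Poly_Mapping.keys (f * g) \<subseteq> monomials n"
    using Poly_Mapping.keys_mult[of f g] monomials_add by (fastforce simp: coord_ring_def)
  then show ?case by (simp add: coord_ring_def)
qed (auto simp: coord_ring_def monomials_0 algebra_simps)


section \<open>The reciprocal graph\<close>

text \<open>Closed subsets of the \<open>k\<close>-scheme \<open>P^n \<times> P^n\<close> are determined by their geometric points,
  that is, their points over the algebraic closure of \<open>k\<close>.  A point of \<open>P^n \<times> P^n\<close> is given by a
  pair of nonzero coordinate vectors, and a set of points by the set of all representatives of
  its members.  Vectors are functions on \<open>nat\<close> of which only the coordinates \<open>0, \<dots>, n\<close> are used.\<close>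

type_synonym 'k geom_vec = "nat \<Rightarrow> 'k alg_closure"

definition bieval :: "'k::field bipoly \<Rightarrow> 'k geom_vec \<times> 'k geom_vec \<Rightarrow> 'k alg_closure" where
  "bieval f p = (\<Sum>m\<in>Poly_Mapping.keys f. to_ac (Poly_Mapping.lookup f m) *
     (\<Prod>v\<in>Poly_Mapping.keys m. (case v of XVar i \<Rightarrow> fst p i | YVar i \<Rightarrow> snd p i) ^ Poly_Mapping.lookup m v))"

definition biproj_points :: "nat \<Rightarrow> ('k::field geom_vec \<times> 'k geom_vec) set" where
  "biproj_points n = {(z, w). (\<exists>i\<le>n. z i \<noteq> 0) \<and> (\<exists>i\<le>n. w i \<noteq> 0)}"

text \<open>Base change to the algebraic closure of the image of \<open>L\<close> in \<open>k^(n+1)\<close>: the span over the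
  algebraic closure of the vectors \<open>(x 0 v, \<dots>, x n v)\<close>.  It has points outside the coordinate
  hyperplanes even when \<open>k\<close> is too small for \<open>L\<close> to have any.\<close>

definition geom_space :: "nat \<Rightarrow> (nat \<Rightarrow> 'v \<Rightarrow> 'k::field) \<Rightarrow> 'k geom_vec set" where
  "geom_space n x =
     {z. \<exists>V c. finite V \<and> (\<forall>i\<le>n. z i = (\<Sum>v\<in>V. c v * to_ac (x i v)))}"

definition cremona_graph ::
    "nat \<Rightarrow> (nat \<Rightarrow> 'v \<Rightarrow> 'k::field) \<Rightarrow> ('k geom_vec \<times> 'k geom_vec) set" where
  "cremona_graph n x =
     {(z, w). z \<in> geom_space n x \<and> (\<forall>i\<le>n. z i \<noteq> 0) \<and>
        (\<exists>c. c \<noteq> 0 \<and> (\<forall>i\<le>n. w i = c * inverse (z i)))}"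

text \<open>Zariski closure in the \<open>k\<close>-scheme, whence the polynomials have coefficients in \<open>k\<close>.\<close>

definition bizariski_closure ::
    "nat \<Rightarrow> ('k::field geom_vec \<times> 'k geom_vec) set \<Rightarrow> ('k geom_vec \<times> 'k geom_vec) set" where
  "bizariski_closure n A = {p \<in> biproj_points n.
     \<forall>f. bihomogeneous n f \<and> (\<forall>q\<in>A. bieval f q = 0) \<longrightarrow> bieval f p = 0}"

definition reciprocal_graph ::
    "nat \<Rightarrow> (nat \<Rightarrow> 'v \<Rightarrow> 'k::field) \<Rightarrow> ('k geom_vec \<times> 'k geom_vec) set" where
  "reciprocal_graph n x = bizariski_closure n (cremona_graph n x)"

definition reciprocal_ideal :: "nat \<Rightarrow> (nat \<Rightarrow> 'v \<Rightarrow> 'k::field) \<Rightarrow> 'k bipoly set" where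
  "reciprocal_ideal n x = Idl\<^bsub>coord_ring n\<^esub>
     {f. bihomogeneous n f \<and> (\<forall>p\<in>reciprocal_graph n x. bieval f p = 0)}"


section \<open>Term orders and initial ideals\<close>

text \<open>Orders are given as relations: \<open>(s, t) \<in> T\<close> means that \<open>s\<close> is less than or equal to \<open>t\<close>.\<close>

definition term_order :: "nat \<Rightarrow> monomial rel \<Rightarrow> bool" where
  "term_order n T \<longleftrightarrow> linear_order_on (monomials n) T \<and>
     (\<forall>m\<in>monomials n. (0, m) \<in> T) \<and>
     (\<forall>s t. \<forall>u\<in>monomials n. (s, t) \<in> T \<longrightarrow> (s + u, t + u) \<in> T)"

definition init_term :: "monomial rel \<Rightarrow> 'k::field bipoly \<Rightarrow> monomial" where
  "init_term T f = (THE m. m \<in> Poly_Mapping.keys f \<and> (\<forall>m'\<in>Poly_Mapping.keys f. (m', m) \<in> T))"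

definition init_ideal :: "nat \<Rightarrow> monomial rel \<Rightarrow> 'k::field bipoly set \<Rightarrow> 'k bipoly set" where
  "init_ideal n T I = Idl\<^bsub>coord_ring n\<^esub> {pterm (init_term T f) | f. f \<in> I \<and> f \<noteq> 0}"


section \<open>No broken circuit complexes\<close>

definition nbc_complex :: "nat \<Rightarrow> (nat \<Rightarrow> 'v \<Rightarrow> 'k::field) \<Rightarrow> nat set set" where
  "nbc_complex n x = {F. F \<subseteq> {..n} \<and> \<not> (\<exists>B. broken_circuit n x B \<and> B \<subseteq> F)}"

definition rnbc_complex :: "nat \<Rightarrow> (nat \<Rightarrow> 'v \<Rightarrow> 'k::field) \<Rightarrow> nat set set" where
  "rnbc_complex n x = {F \<in> nbc_complex n x. 0 \<notin> F}"

definition upset :: "nat \<Rightarrow> nat rel \<Rightarrow> nat \<Rightarrow> nat set" where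
  "upset n P i = {j \<in> {..n}. (i, j) \<in> P}"

definition lex_basis ::
    "nat \<Rightarrow> (nat \<Rightarrow> 'v \<Rightarrow> 'k::field) \<Rightarrow> nat rel \<Rightarrow> nat set \<Rightarrow> nat set" where
  "lex_basis n x P F =
     {i \<in> {..n}. i \<in> F \<or> rk x (upset n P i \<union> F) > rk x ((upset n P i - {i}) \<union> F)}"

definition enbc_facet ::
    "nat \<Rightarrow> (nat \<Rightarrow> 'v \<Rightarrow> 'k::field) \<Rightarrow> nat rel \<Rightarrow> nat set \<Rightarrow> var set" where
  "enbc_facet n x P F = YVar ` F \<union> XVar ` (lex_basis n x P F - F) \<union> {YVar 0}"

definition enbc_complex ::
    "nat \<Rightarrow> (nat \<Rightarrow> 'v \<Rightarrow> 'k::field) \<Rightarrow> nat rel \<Rightarrow> var set set" where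
  "enbc_complex n x P = {G. \<exists>F \<in> rnbc_complex n x. G \<subseteq> enbc_facet n x P F}"

definition stanley_reisner_ideal :: "nat \<Rightarrow> var set set \<Rightarrow> 'k::field bipoly set" where
  "stanley_reisner_ideal n \<Delta> =
     Idl\<^bsub>coord_ring n\<^esub> {\<Prod>v\<in>A. pvar v | A. A \<subseteq> bivars n \<and> A \<notin> \<Delta>}"

end

theory Submission
  imports Defs "HOL-Library.Function_Algebras"
begin

text \<open>The theorem is proved by squeezing the reciprocal ideal between two ideals that turn out to be
equal. Let \<open>J\<close> be the ideal generated by the listed polynomials and let \<open>V\<close> be the ideal of all
polynomials that vanish on the graph of the Cremona transformation, seen as a set of pairs of
coordinate vectors over the algebraic closure. The reciprocal ideal contains \<open>J\<close>, because the
generators are bihomogeneous and vanish on the graph, and it is contained in \<open>V\<close>, because taking a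
Zariski closure does not change the bihomogeneous polynomials that vanish.

Call a monomial standard if its support contains none of the supports of the monomials in the
second assertion; these supports are collected in \<open>enbc_nonfaces\<close>. Each of them is the support of the
leading term of an element of \<open>J\<close> that is homogeneous in the total degree (\<open>nonface_relation\<close>): a
broken circuit is the leading term of the Cremona transform of its circuit relation, and
\<open>x j * (\<Prod>i\<in>I. py i)\<close> leads the product of \<open>\<Prod>i\<in>I. py i\<close> with a linear relation that expresses the
form \<open>x j\<close> by later forms and by forms from \<open>I\<close>; the terms that would be too large contain some
\<open>px i * py i\<close>, which is congruent to \<open>px 0 * py 0\<close>, and multiples of \<open>py 0\<close> are small. Hence every
polynomial is congruent modulo \<open>J\<close> to a combination of standard monomials, and this remainder is
nonzero whenever the leading term of the polynomial is standard (\<open>normal_form\<close>). As all the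
relations are homogeneous, the reduction moves inside a finite set of monomials and ends for every
term order.

The heart of the proof is that the standard monomials are linearly independent as functions on the
graph (\<open>standard_polynomial_eq_0\<close>). Then an element of \<open>V\<close> has remainder \<open>0\<close>: so \<open>V \<subseteq> J\<close>, which is the
first assertion, and no leading term of a nonzero element of \<open>V\<close> is standard, which is the second.
The third is combinatorial: a set of variables is a nonface of the extended no broken circuit
complex exactly if it contains a member of \<open>enbc_nonfaces\<close> (\<open>not_in_enbc_complex_iff\<close>).

For the independence, let \<open>F\<close> be the set of nonzero indices of the \<open>y\<close>-variables in a standard
monomial. It contains no broken circuit, and the indices of the \<open>x\<close>-variables lie in \<open>L(F) - F\<close>. On
the graph \<open>y i\<close> is a multiple of \<open>1 / x i\<close>, and the scalings of the second factor separate the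
\<open>y\<close>-degrees. What remains is a statement on partial fractions (\<open>partial_fractions_independent\<close>): the
functions \<open>x^\<alpha> * (\<Prod>k\<in>F. (x 0 / x k)^\<beta> k)\<close>, with all \<open>\<beta> k\<close> positive and \<open>\<alpha>\<close> supported on a set \<open>E(F)\<close>
disjoint from \<open>F\<close> for which the forms in \<open>E(F) \<union> F\<close> are independent, are themselves independent. It is
proved by removing the last form: multiply by the highest power of it that occurs in a denominator
and restrict to its zero set, where only the terms with the highest pole survive.

The induction is short because the matroid enters only through points. That \<open>F\<close> contains no broken
circuit means that each form is nonzero at some point where all larger members of \<open>F\<close> vanish, and
independence means that each form is nonzero at some point where the others vanish. When \<open>m \<in> F\<close> is
the last form, the points needed for the smaller forms already lie on the zero set of \<open>m\<close>, so the
hypotheses restrict to it without any contraction of matroids. The points exist over the ground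
field, by duality of vector spaces; only the vanishing of polynomial functions needs the infinite
algebraic closure.\<close>


section \<open>Linear algebra of families of forms\<close>

text \<open>Stated for indices rather than for sets of forms, so that it makes sense for families with
  repetitions and agrees with the way in which the matroid is given.\<close>

definition in_span :: "(nat \<Rightarrow> 'v \<Rightarrow> 'k::field) \<Rightarrow> nat \<Rightarrow> nat set \<Rightarrow> bool" where
  "in_span x j D \<longleftrightarrow> (\<exists>b. \<forall>v. x j v = (\<Sum>k\<in>D. b k * x k v))"

lemma in_spanI: "(\<And>v. x j v = (\<Sum>k\<in>D. b k * x k v)) \<Longrightarrow> in_span x j D"
  unfolding in_span_def by (rule exI[of _ b]) simp

lemma in_span_mono:
  assumes "in_span x j D" "D \<subseteq> D'" "finite D'"
  shows "in_span x j D'"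
proof -
  from assms(1) obtain b where b: "\<And>v. x j v = (\<Sum>k\<in>D. b k * x k v)"
    unfolding in_span_def by blast
  have "x j v = (\<Sum>k\<in>D'. (if k \<in> D then b k else 0) * x k v)" for v
  proof -
    have "(\<Sum>k\<in>D'. (if k \<in> D then b k else 0) * x k v) = (\<Sum>k\<in>D. (if k \<in> D then b k else 0) * x k v)"
      by (rule sum.mono_neutral_right) (use assms in auto)
    then show ?thesis using b by simp
  qed
  then show ?thesis by (rule in_spanI)
qed

lemma in_span_self:
  assumes "j \<in> D" "finite D"
  shows "in_span x j D"
  unfolding in_span_def
  by (rule exI[of _ "\<lambda>k. if k = j then 1 else 0"])
     (use assms in \<open>simp add: if_distrib[of "\<lambda>c. c * _"] cong: if_cong\<close>)

lemma in_span_of_relation: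
  assumes rel: "\<And>v. (\<Sum>i\<in>C. c i * x i v) = 0" and C: "finite C" "j \<in> C" and c: "c j \<noteq> 0"
  shows "in_span x j (C - {j})"
proof -
  have "x j v = (\<Sum>i\<in>C - {j}. (- c i / c j) * x i v)" for v
  proof -
    have "c j * x j v = - (\<Sum>i\<in>C - {j}. c i * x i v)"
      using rel[of v] sum.remove[OF C, of "\<lambda>i. c i * x i v"] by (simp add: eq_neg_iff_add_eq_0)
    then have "x j v = - (\<Sum>i\<in>C - {j}. c i * x i v) / c j"
      using c by (simp add: field_simps)
    also have "\<dots> = (\<Sum>i\<in>C - {j}. (- c i / c j) * x i v)"
      by (simp add: sum_negf[symmetric] sum_divide_distrib)
    finally show ?thesis .
  qed
  then show ?thesis by (rule in_spanI)
qed

text \<open>A constant of its own, because an abstraction in the role of the scalar multiplication would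
  make the simplification rules of vector spaces apply to all functions into the field.\<close>

definition scale_form :: "'k::field \<Rightarrow> ('v \<Rightarrow> 'k) \<Rightarrow> 'v \<Rightarrow> 'k" where
  "scale_form c f = (\<lambda>v. c * f v)"

interpretation forms: vector_space scale_form
  by standard (auto simp: fun_eq_iff algebra_simps scale_form_def)

lemma in_span_iff_span:
  fixes x :: "nat \<Rightarrow> 'v \<Rightarrow> 'k::field"
  assumes "finite D"
  shows "in_span x j D \<longleftrightarrow> x j \<in> forms.span (x ` D)"
proof -
  have sum_app: "(\<Sum>k\<in>S. scale_form (b k) (y k)) v = (\<Sum>k\<in>S. b k * y k v)"
    for S :: "'z set" and b and y :: "'z \<Rightarrow> 'v \<Rightarrow> 'k" and v
    by (induction S rule: infinite_finite_induct) (auto simp: scale_form_def)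
  show ?thesis
  proof
    assume "in_span x j D"
    then obtain b where b: "\<And>v. x j v = (\<Sum>k\<in>D. b k * x k v)" unfolding in_span_def by blast
    then have "x j = (\<Sum>k\<in>D. scale_form (b k) (x k))" by (simp add: fun_eq_iff sum_app)
    moreover have "(\<Sum>k\<in>D. scale_form (b k) (x k)) \<in> forms.span (x ` D)"
      by (intro forms.span_sum forms.span_scale forms.span_base) auto
    ultimately show "x j \<in> forms.span (x ` D)" by simp
  next
    assume "x j \<in> forms.span (x ` D)"
    then obtain u where u: "x j = (\<Sum>f\<in>x ` D. scale_form (u f) f)"
      using forms.span_finite[of "x ` D"] assms by auto
    obtain D' where D': "D' \<subseteq> D" "inj_on x D'" "x ` D = x ` D'"
      using subset_image_inj[of "x ` D" x D] by auto
    have "x j v = (\<Sum>k\<in>D'. u (x k) * x k v)" for v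
      unfolding u D'(3) sum_app using sum.reindex[OF D'(2), of "\<lambda>f. u f * f v"] by simp
    then have "in_span x j D'" by (rule in_spanI)
    then show "in_span x j D" using D' assms in_span_mono by blast
  qed
qed

lemma independent_forms_iff:
  fixes x :: "nat \<Rightarrow> 'v \<Rightarrow> 'k::field"
  assumes "finite B"
  shows "independent_forms x B \<longleftrightarrow> (\<forall>j\<in>B. \<not> in_span x j (B - {j}))"
proof
  assume ind: "independent_forms x B"
  show "\<forall>j\<in>B. \<not> in_span x j (B - {j})"
  proof (intro ballI notI)
    fix j assume j: "j \<in> B" and "in_span x j (B - {j})"
    then obtain b where b: "\<And>v. x j v = (\<Sum>k\<in>B - {j}. b k * x k v)" unfolding in_span_def by blast
    define c where "c k = (if k = j then - 1 else b k)" for k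
    have "(\<Sum>k\<in>B. c k * x k v) = 0" for v
    proof -
      have "(\<Sum>k\<in>B. c k * x k v) = c j * x j v + (\<Sum>k\<in>B - {j}. c k * x k v)"
        using assms j by (simp add: sum.remove)
      also have "(\<Sum>k\<in>B - {j}. c k * x k v) = (\<Sum>k\<in>B - {j}. b k * x k v)"
        by (rule sum.cong) (auto simp: c_def)
      finally show ?thesis using b[of v] by (simp add: c_def)
    qed
    then have "c j = 0" using ind j unfolding independent_forms_def by blast
    then show False by (simp add: c_def)
  qed
next
  assume H: "\<forall>j\<in>B. \<not> in_span x j (B - {j})"
  show "independent_forms x B"
    unfolding independent_forms_def
  proof (intro allI impI ballI, rule ccontr)
    fix c j assume "\<forall>v. (\<Sum>i\<in>B. c i * x i v) = 0" "j \<in> B" "c j \<noteq> 0"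
    then have "in_span x j (B - {j})" using in_span_of_relation[of c x B j] assms by blast
    then show False using H \<open>j \<in> B\<close> by blast
  qed
qed

lemma independent_forms_iff_independent:
  fixes x :: "nat \<Rightarrow> 'v \<Rightarrow> 'k::field"
  assumes "finite B"
  shows "independent_forms x B \<longleftrightarrow> inj_on x B \<and> forms.independent (x ` B)"
proof -
  have eq: "x ` (B - {j}) = x ` B - {x j}" if "inj_on x B" "j \<in> B" for j
    using that by (auto simp: inj_on_def)
  have "inj_on x B" if "\<forall>j\<in>B. x j \<notin> forms.span (x ` (B - {j}))"
  proof (rule inj_onI, rule ccontr)
    fix i j assume "i \<in> B" "j \<in> B" "x i = x j" "i \<noteq> j"
    then have "x j \<in> x ` (B - {j})" by (intro image_eqI[of _ _ i]) simp_all
    then have "x j \<in> forms.span (x ` (B - {j}))" by (rule forms.span_base)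
    then show False using that \<open>j \<in> B\<close> by simp
  qed
  moreover have "independent_forms x B \<longleftrightarrow> (\<forall>j\<in>B. x j \<notin> forms.span (x ` (B - {j})))"
    by (simp add: independent_forms_iff[OF assms] in_span_iff_span assms)
  moreover have "forms.independent (x ` B) \<longleftrightarrow> (\<forall>j\<in>B. x j \<notin> forms.span (x ` (B - {j})))" if "inj_on x B"
    unfolding forms.dependent_def using eq[OF that] by simp
  ultimately show ?thesis by blast
qed

text \<open>A basis of the span chosen among the forms is the image of an independent set of indices, and
  by the exchange property no independent set of indices is larger.\<close>

lemma rk_eq_dim:
  fixes x :: "nat \<Rightarrow> 'v \<Rightarrow> 'k::field"
  assumes "finite A"
  shows "rk x A = forms.dim (x ` A)"
proof -
  obtain S where S: "S \<subseteq> x ` A" "forms.independent S" "x ` A \<subseteq> forms.span S" "card S = forms.dim (x ` A)"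
    by (rule forms.basis_exists)
  obtain B where B: "B \<subseteq> A" "inj_on x B" "S = x ` B"
    using S(1) by (auto simp: subset_image_inj)
  have finB: "finite B" using B(1) assms finite_subset by blast
  show ?thesis
    unfolding rk_def
  proof (rule Max_eqI)
    have "{card B | B. B \<subseteq> A \<and> independent_forms x B} \<subseteq> card ` Pow A" by auto
    then show "finite {card B | B. B \<subseteq> A \<and> independent_forms x B}"
      using assms finite_surj[of "Pow A"] by simp
  next
    fix y assume "y \<in> {card B | B. B \<subseteq> A \<and> independent_forms x B}"
    then obtain B' where B': "B' \<subseteq> A" "independent_forms x B'" "y = card B'" by blast
    have finB': "finite B'" using B'(1) assms finite_subset by blast
    have "inj_on x B'" "forms.independent (x ` B')"
      using B'(2) independent_forms_iff_independent[OF finB'] by auto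
    moreover have "x ` B' \<subseteq> forms.span S" using B'(1) S(3) by blast
    moreover have "finite S" using B(3) finB by simp
    ultimately show "y \<le> forms.dim (x ` A)"
      using forms.independent_span_bound[of S "x ` B'"] S(4) B'(3) by (simp add: card_image)
  next
    have "independent_forms x B"
      using independent_forms_iff_independent[OF finB] B S(2) by auto
    moreover have "card B = forms.dim (x ` A)" using S(4) B by (simp add: card_image)
    ultimately show "forms.dim (x ` A) \<in> {card B | B. B \<subseteq> A \<and> independent_forms x B}"
      using B(1) by (intro CollectI exI[of _ B]) simp
  qed
qed

text \<open>All rank conditions of the theorem compare a set with the same set and one more element, so
  this turns them into span conditions.\<close>

lemma rk_insert:
  fixes x :: "nat \<Rightarrow> 'v \<Rightarrow> 'k::field"
  assumes "finite D"
  shows "rk x (insert j D) = (if in_span x j D then rk x D else Suc (rk x D))"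
proof (cases "in_span x j D")
  case True
  then have "x j \<in> forms.span (x ` D)" by (rule in_span_iff_span[OF assms, THEN iffD1])
  then have "forms.span (insert (x j) (x ` D)) = forms.span (x ` D)" by (rule forms.span_redundant)
  then have "forms.dim (insert (x j) (x ` D)) = forms.dim (x ` D)" by (rule forms.span_eq_dim)
  then show ?thesis
    using True assms by (simp add: rk_eq_dim)
next
  case False
  then have ns: "x j \<notin> forms.span (x ` D)" by (rule contrapos_nn) (rule in_span_iff_span[OF assms, THEN iffD2])
  obtain S where S: "S \<subseteq> x ` D" "forms.independent S" "x ` D \<subseteq> forms.span S" "card S = forms.dim (x ` D)"
    by (rule forms.basis_exists)
  have nS: "x j \<notin> forms.span S" using ns forms.span_mono[OF S(1)] by auto
  have "finite S" using S(1) assms finite_subset by blast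
  moreover have "x j \<notin> S" using nS forms.span_base[of "x j" S] by auto
  moreover have "forms.dim (insert (x j) (x ` D)) = card (insert (x j) S)"
  proof (rule forms.dim_unique)
    show "insert (x j) S \<subseteq> insert (x j) (x ` D)" using S(1) by blast
    show "insert (x j) (x ` D) \<subseteq> forms.span (insert (x j) S)"
      using S(3) forms.span_base[of "x j" "insert (x j) S"] forms.span_mono[of S "insert (x j) S"] by auto
    show "forms.independent (insert (x j) S)" using nS S(2) by (rule forms.independent_insertI)
  qed simp
  ultimately show ?thesis
    using False assms S(4) by (simp add: rk_eq_dim)
qed

lemma rk_insert_eq_iff:
  assumes "finite D"
  shows "rk x (insert j D) = rk x D \<longleftrightarrow> in_span x j D"
  using rk_insert[OF assms, of x j] by auto

lemma rk_insert_gt_iff: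
  assumes "finite D"
  shows "rk x (insert j D) > rk x D \<longleftrightarrow> \<not> in_span x j D"
  using rk_insert[OF assms, of x j] by auto

lemma linear_form_iff:
  fixes scale :: "'k::field \<Rightarrow> 'v::ab_group_add \<Rightarrow> 'v"
  assumes "vector_space scale"
  shows "Vector_Spaces.linear scale (*) f \<longleftrightarrow>
    (\<forall>u v. f (u + v) = f u + f v) \<and> (\<forall>c v. f (scale c v) = c * f v)"
proof -
  have "vector_space ((*) :: 'k \<Rightarrow> 'k \<Rightarrow> 'k)" by standard (auto simp: algebra_simps)
  then show ?thesis using assms by (simp add: Vector_Spaces.linear_iff)
qed

text \<open>The dual description of spans.  In the induction, \<open>f\<close> is corrected by a multiple of \<open>x d\<close> so
  that it vanishes on the common zeros of the forms in \<open>D\<close> alone.\<close>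

lemma in_span_of_common_zeros:
  fixes scale :: "'k::field \<Rightarrow> 'v::ab_group_add \<Rightarrow> 'v"
  assumes vs: "vector_space scale"
    and finD: "finite D" and lin: "\<And>k. k \<in> D \<Longrightarrow> Vector_Spaces.linear scale (*) (x k)"
    and linj: "Vector_Spaces.linear scale (*) (x j)"
    and zero: "\<And>v. (\<forall>k\<in>D. x k v = 0) \<Longrightarrow> x j v = 0"
  shows "in_span x j D"
proof -
  have "\<exists>b. \<forall>v. f v = (\<Sum>k\<in>D. b k * x k v)"
    if f: "Vector_Spaces.linear scale (*) f" "\<forall>v. (\<forall>k\<in>D. x k v = 0) \<longrightarrow> f v = 0" for f
    using finD lin f
  proof (induction D arbitrary: f rule: finite_induct)
    case empty
    then show ?case by simp
  next
    case (insert d D)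
    have lin_D: "\<And>k. k \<in> D \<Longrightarrow> Vector_Spaces.linear scale (*) (x k)" and lin_d: "Vector_Spaces.linear scale (*) (x d)"
      using insert.prems(1) by simp_all
    have combine: "\<exists>b. \<forall>v. f v = (\<Sum>k\<in>insert d D. b k * x k v)"
      if "\<And>v. f v - c * x d v = (\<Sum>k\<in>D. b k * x k v)" for b c
    proof (intro exI allI)
      fix v
      have "(\<Sum>k\<in>D. (b(d := c)) k * x k v) = (\<Sum>k\<in>D. b k * x k v)"
        by (rule sum.cong[OF refl]) (use insert.hyps in auto)
      then show "f v = (\<Sum>k\<in>insert d D. (b(d := c)) k * x k v)"
        using that[of v] insert.hyps by (simp add: diff_eq_eq)
    qed
    show ?case
    proof (cases "\<forall>v. (\<forall>k\<in>D. x k v = 0) \<longrightarrow> x d v = 0")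
      case True
      then have "\<forall>v. (\<forall>k\<in>D. x k v = 0) \<longrightarrow> f v = 0" using insert.prems(3) by blast
      from insert.IH[OF lin_D insert.prems(2) this] obtain b where
        "\<And>v. f v = (\<Sum>k\<in>D. b k * x k v)" by blast
      then show ?thesis by (intro combine[of 0 b]) simp
    next
      case False
      then obtain u where u: "\<And>k. k \<in> D \<Longrightarrow> x k u = 0" "x d u \<noteq> 0" by blast
      define c where "c = f u / x d u"
      define g where "g = (\<lambda>v. f v - c * x d v)"
      have g: "Vector_Spaces.linear scale (*) g"
        using insert.prems(2) lin_d unfolding linear_form_iff[OF vs] g_def by (simp add: algebra_simps)
      have "\<forall>v. (\<forall>k\<in>D. x k v = 0) \<longrightarrow> g v = 0"
      proof (intro allI impI)
        fix v assume v: "\<forall>k\<in>D. x k v = 0"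
        \<comment> \<open>subtracting a multiple of \<open>u\<close> moves \<open>v\<close> into the zero set of \<open>x d\<close>\<close>
        define w where "w = v + scale (- (x d v / x d u)) u"
        have at_w: "h w = h v - (x d v / x d u) * h u" if "Vector_Spaces.linear scale (*) h" for h :: "'v \<Rightarrow> 'k"
          using that unfolding linear_form_iff[OF vs] w_def by simp
        have "x k w = 0" if "k \<in> D" for k using at_w[OF lin_D[OF that]] u(1) v that by simp
        moreover have "x d w = 0" using at_w[OF lin_d] u(2) by simp
        ultimately have "\<forall>k\<in>insert d D. x k w = 0" by simp
        then have "f w = 0" using insert.prems(3) by blast
        then show "g v = 0" using at_w[OF insert.prems(2)] by (simp add: g_def c_def)
      qed
      from insert.IH[OF lin_D g this] obtain b where "\<And>v. g v = (\<Sum>k\<in>D. b k * x k v)" by blast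
      then show ?thesis by (intro combine[of c b]) (simp add: g_def)
    qed
  qed
  then obtain b where "\<And>v. x j v = (\<Sum>k\<in>D. b k * x k v)" using linj zero by blast
  then show ?thesis by (rule in_spanI)
qed


section \<open>Broken circuits and the lexicographic basis\<close>

lemma dependent_contains_circuit:
  assumes "D \<subseteq> {..n}" "\<not> independent_forms x D"
  obtains C where "C \<subseteq> D" "matroid_circuit n x C"
proof -
  have "finite D" using assms(1) finite_subset by blast
  then have "\<exists>C\<subseteq>D. matroid_circuit n x C" using assms
  proof (induction D rule: finite_psubset_induct)
    case (psubset D)
    show ?case
    proof (cases "\<exists>E. E \<subset> D \<and> \<not> independent_forms x E")
      case True
      then obtain E where E: "E \<subset> D" "\<not> independent_forms x E" by blast
      with psubset.IH[OF E(1)] psubset.prems show ?thesis by blast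
    next
      case False
      then show ?thesis using psubset.prems unfolding matroid_circuit_def by blast
    qed
  qed
  then show ?thesis using that by blast
qed

lemma circuit_properties:
  assumes "matroid_circuit n x C"
  shows "finite C" "C \<noteq> {}" "Min C \<in> C" "\<And>i. i \<in> C \<Longrightarrow> i \<le> n"
proof -
  show "finite C" using assms finite_subset unfolding matroid_circuit_def by blast
  moreover show "C \<noteq> {}" using assms unfolding matroid_circuit_def independent_forms_def by auto
  ultimately show "Min C \<in> C" by simp
  show "\<And>i. i \<in> C \<Longrightarrow> i \<le> n" using assms unfolding matroid_circuit_def by auto
qed

lemma broken_circuit_subset:
  assumes "broken_circuit n x B"
  shows "B \<subseteq> {1..n}"
proof
  fix i assume "i \<in> B"
  then obtain C where C: "matroid_circuit n x C" "i \<in> C" "i \<noteq> Min C"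
    using assms unfolding broken_circuit_def by blast
  note c = circuit_properties[OF C(1)]
  then have "Min C < i" using C(2,3) by (metis Min_le le_neq_implies_less)
  then show "i \<in> {1..n}" using c(4)[OF C(2)] by simp
qed

text \<open>A dependent set contains a circuit and with it a broken circuit.\<close>

lemma nbc_independent:
  assumes "F \<in> nbc_complex n x"
  shows "independent_forms x F"
proof (rule ccontr)
  assume "\<not> ?thesis"
  then obtain C where "C \<subseteq> F" "matroid_circuit n x C"
    using assms dependent_contains_circuit[of F n x] unfolding nbc_complex_def by blast
  then show False using assms unfolding nbc_complex_def broken_circuit_def by blast
qed

text \<open>If \<open>x i\<close> were in this span, then \<open>i\<close> together with larger members of \<open>F\<close> would contain a circuit.
  Whether or not \<open>i\<close> belongs to the circuit, deleting its minimum leaves a subset of \<open>F\<close>, that is, a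
  broken circuit inside \<open>F\<close>.\<close>

lemma nbc_not_in_span_of_larger:
  assumes F: "F \<in> nbc_complex n x" and i: "i \<le> n"
  shows "\<not> in_span x i {j \<in> F. i < j}"
proof
  let ?D = "{j \<in> F. i < j}"
  assume sp: "in_span x i ?D"
  have sub: "insert i ?D \<subseteq> {..n}" using F i unfolding nbc_complex_def by auto
  then have "finite (insert i ?D)" by (rule finite_subset) simp
  moreover have "insert i ?D - {i} = ?D" by auto
  ultimately have "\<not> independent_forms x (insert i ?D)"
    using sp independent_forms_iff[of "insert i ?D" x] by (metis insertI1)
  then obtain C where C: "C \<subseteq> insert i ?D" "matroid_circuit n x C"
    using dependent_contains_circuit[OF sub] by blast
  note c = circuit_properties[OF C(2)]
  have "C - {Min C} \<subseteq> F"
  proof (cases "i \<in> C")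
    case True
    then have "Min C = i" using C(1) c by (intro Min_eqI) auto
    then show ?thesis using C(1) by blast
  qed (use C(1) in blast)
  then show False using F C(2) unfolding nbc_complex_def broken_circuit_def by blast
qed

locale linear_forms =
  fixes scale :: "'k::field \<Rightarrow> 'v::ab_group_add \<Rightarrow> 'v"
    and x :: "nat \<Rightarrow> 'v \<Rightarrow> 'k"
    and n :: nat
  assumes vs: "vector_space scale"
    and lin: "\<And>i. i \<le> n \<Longrightarrow> Vector_Spaces.linear scale (*) (x i)"
begin

lemma separating_vector:
  assumes "D \<subseteq> {..n}" "j \<le> n" "\<not> in_span x j D"
  obtains v where "x j v \<noteq> 0" "\<And>k. k \<in> D \<Longrightarrow> x k v = 0"
proof -
  have "finite D" using assms(1) finite_subset by blast
  then show ?thesis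
    using in_span_of_common_zeros[OF vs, of D x j] assms lin that by blast
qed

end

locale ordered_forms = linear_forms scale x n
  for scale :: "'k::field \<Rightarrow> 'v::ab_group_add \<Rightarrow> 'v" and x :: "nat \<Rightarrow> 'v \<Rightarrow> 'k" and n +
  fixes P :: "nat rel"
  assumes P: "linear_order_on {..n} P"
begin

lemma P_order:
  shows "(i, j) \<in> P \<Longrightarrow> i \<le> n \<and> j \<le> n"
    and "i \<le> n \<Longrightarrow> (i, i) \<in> P"
    and "(i, j) \<in> P \<Longrightarrow> (j, k) \<in> P \<Longrightarrow> (i, k) \<in> P"
    and "(i, j) \<in> P \<Longrightarrow> (j, i) \<in> P \<Longrightarrow> i = j"
    and "i \<le> n \<Longrightarrow> j \<le> n \<Longrightarrow> (i, j) \<in> P \<or> (j, i) \<in> P"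
proof -
  have facts: "P \<subseteq> {..n} \<times> {..n}" "refl_on {..n} P" "trans P" "antisym P" "total_on {..n} P"
    using P by (simp_all add: order_on_defs)
  show "(i, j) \<in> P \<Longrightarrow> i \<le> n \<and> j \<le> n" using facts(1) by auto
  show refl: "i \<le> n \<Longrightarrow> (i, i) \<in> P" using facts(2) by (simp add: refl_on_def)
  show "(i, j) \<in> P \<Longrightarrow> (j, k) \<in> P \<Longrightarrow> (i, k) \<in> P" by (rule transD[OF facts(3)])
  show "(i, j) \<in> P \<Longrightarrow> (j, i) \<in> P \<Longrightarrow> i = j" by (rule antisymD[OF facts(4)])
  show "i \<le> n \<Longrightarrow> j \<le> n \<Longrightarrow> (i, j) \<in> P \<or> (j, i) \<in> P"
    using facts(5) refl by (cases "i = j") (auto simp: total_on_def)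
qed

definition after :: "nat \<Rightarrow> nat set" where
  "after j = upset n P j - {j}"

lemma after_iff: "k \<in> after j \<longleftrightarrow> (j, k) \<in> P \<and> k \<noteq> j"
  using P_order(1) unfolding after_def upset_def by auto

lemma after_subset: "after j \<subseteq> {..n}"
  unfolding after_def upset_def by auto

lemma finite_after: "finite (after j)"
  using after_subset finite_subset by blast

lemma upset_eq: "j \<le> n \<Longrightarrow> upset n P j = insert j (after j)"
  using P_order(2) unfolding after_def upset_def by auto

lemma upset_minus: "upset n P j - {j} = after j"
  by (simp add: after_def)

lemma rk_upset_eq_iff:
  assumes "j \<le> n" "finite I"
  shows "rk x (upset n P j \<union> I) = rk x ((upset n P j - {j}) \<union> I) \<longleftrightarrow> in_span x j (after j \<union> I)"
  unfolding upset_minus unfolding upset_eq[OF assms(1)]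
  using rk_insert_eq_iff[of "after j \<union> I" x j] assms finite_after by simp

text \<open>The greedy description of the lexicographic basis: from the \<open>P\<close>-largest element downwards, an
  element is kept if its form is not yet spanned.  Members of \<open>F\<close> are spanned at once.\<close>

lemma lex_basis_minus:
  assumes "F \<subseteq> {..n}"
  shows "lex_basis n x P F - F = {j. j \<le> n \<and> \<not> in_span x j (after j \<union> F)}"
proof -
  have finF: "finite F" using assms finite_subset by blast
  have "rk x (upset n P j \<union> F) > rk x ((upset n P j - {j}) \<union> F) \<longleftrightarrow> \<not> in_span x j (after j \<union> F)"
    if "j \<le> n" for j
    unfolding upset_minus unfolding upset_eq[OF that]
    using rk_insert_gt_iff[of "after j \<union> F" x j] finF finite_after by simp
  moreover have "in_span x j (after j \<union> F)" if "j \<in> F" for j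
    using in_span_self[of j "after j \<union> F"] that finF finite_after by blast
  ultimately show ?thesis unfolding lex_basis_def by auto
qed

text \<open>The greedy choice makes every relation triangular: the \<open>P\<close>-least index outside \<open>F\<close> with a nonzero
  coefficient would be spanned by later indices and \<open>F\<close>.  So a relation involves only \<open>F\<close>, which is
  independent.\<close>

lemma lex_basis_independent:
  assumes F: "F \<in> nbc_complex n x"
  shows "independent_forms x ((lex_basis n x P F - F) \<union> F)"
proof -
  have Fn: "F \<subseteq> {..n}" using F unfolding nbc_complex_def by blast
  then have finF: "finite F" using finite_subset by blast
  define E where "E = lex_basis n x P F - F"
  have E: "E = {j. j \<le> n \<and> \<not> in_span x j (after j \<union> F)}"
    unfolding E_def by (rule lex_basis_minus[OF Fn])
  have finE: "finite E" unfolding E by simp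
  have disj: "E \<inter> F = {}" unfolding E_def by blast
  show ?thesis unfolding E_def[symmetric] independent_forms_def
  proof (intro allI impI)
    fix c assume rel: "\<forall>v. (\<Sum>i\<in>E \<union> F. c i * x i v) = 0"
    have cE: "c i = 0" if "i \<in> E" for i
    proof (rule ccontr)
      assume "c i \<noteq> 0"
      let ?S = "{k \<in> E. c k \<noteq> 0}"
      have S: "finite ?S" "?S \<noteq> {}" using that \<open>c i \<noteq> 0\<close> finE by auto
      \<comment> \<open>the \<open>P\<close>-least element of the support, found as the one with the largest upset\<close>
      obtain k where k: "k \<in> ?S" "\<And>l. l \<in> ?S \<Longrightarrow> card (upset n P l) \<le> card (upset n P k)"
      proof -
        have "Max ((\<lambda>l. card (upset n P l)) ` ?S) \<in> (\<lambda>l. card (upset n P l)) ` ?S"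
          using S by (intro Max_in) auto
        then obtain k where "k \<in> ?S" "card (upset n P k) = Max ((\<lambda>l. card (upset n P l)) ` ?S)"
          by auto
        then show ?thesis using that S(1) by auto
      qed
      have kn: "k \<le> n" using k(1) E by auto
      have least: "l \<in> after k" if l: "l \<in> ?S" "l \<noteq> k" for l
      proof (rule ccontr)
        assume "l \<notin> after k"
        moreover have ln: "l \<le> n" using l(1) E by auto
        ultimately have lk: "(l, k) \<in> P" using P_order(5)[OF kn ln] l(2) after_iff by blast
        have "upset n P k \<subset> upset n P l"
        proof
          show "upset n P k \<subseteq> upset n P l" using P_order(3)[OF lk] unfolding upset_def by blast
          have "l \<in> upset n P l" using ln P_order(2) unfolding upset_def by blast
          moreover have "l \<notin> upset n P k" using P_order(4)[OF lk] l(2) unfolding upset_def by blast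
          ultimately show "upset n P k \<noteq> upset n P l" by blast
        qed
        then have "card (upset n P k) < card (upset n P l)"
          by (intro psubset_card_mono) (auto simp: upset_def)
        then show False using k(2)[OF l(1)] by simp
      qed
      have "(\<Sum>i\<in>?S \<union> F. c i * x i v) = 0" for v
      proof -
        have "(\<Sum>i\<in>?S \<union> F. c i * x i v) = (\<Sum>i\<in>E \<union> F. c i * x i v)"
          by (rule sum.mono_neutral_left) (use finE finF in auto)
        then show ?thesis using rel by simp
      qed
      then have "in_span x k (?S \<union> F - {k})"
        by (rule in_span_of_relation) (use k(1) finE finF in auto)
      moreover have "?S \<union> F - {k} \<subseteq> after k \<union> F" using least by blast
      ultimately have "in_span x k (after k \<union> F)"
        using in_span_mono finF finite_after by blast
      then show False using k(1) E by blast
    qed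
    have "(\<Sum>i\<in>F. c i * x i v) = 0" for v
    proof -
      have "(\<Sum>i\<in>F. c i * x i v) = (\<Sum>i\<in>E \<union> F. c i * x i v)"
        by (rule sum.mono_neutral_left) (use finE finF cE in auto)
      then show ?thesis using rel by simp
    qed
    then have "\<forall>i\<in>F. c i = 0" using nbc_independent[OF F] unfolding independent_forms_def by blast
    then show "\<forall>i\<in>E \<union> F. c i = 0" using cE by blast
  qed
qed


section \<open>The nonfaces of the extended no broken circuit complex\<close>

text \<open>The supports of the monomials that generate the initial ideal.  Minimal nonfaces are among
  them, but they need not all be minimal.\<close>

definition enbc_nonfaces :: "var set set" where
  "enbc_nonfaces = {YVar ` B | B. broken_circuit n x B}
     \<union> {insert (XVar j) (YVar ` I) | j I. j \<le> n \<and> I \<subseteq> {1..n} \<and>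
          rk x (upset n P j \<union> I) = rk x ((upset n P j - {j}) \<union> I)}"

lemma enbc_nonface_cases [consumes 1]:
  assumes "A \<in> enbc_nonfaces"
  obtains (broken) C where "matroid_circuit n x C" "A = YVar ` (C - {Min C})"
  | (spanned) j I where "j \<le> n" "I \<subseteq> {1..n}" "in_span x j (after j \<union> I)"
      "A = insert (XVar j) (YVar ` I)"
proof -
  consider B where "broken_circuit n x B" "A = YVar ` B"
    | j I where "j \<le> n" "I \<subseteq> {1..n}" "A = insert (XVar j) (YVar ` I)"
        "rk x (upset n P j \<union> I) = rk x ((upset n P j - {j}) \<union> I)"
    using assms unfolding enbc_nonfaces_def by blast
  then show ?thesis
  proof cases
    case 1
    then show ?thesis using broken unfolding broken_circuit_def by blast
  next
    case 2
    then have "finite I" using finite_subset by blast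
    then show ?thesis using 2 spanned rk_upset_eq_iff[of j I] by blast
  qed
qed

lemma enbc_nonfacesI:
  assumes "j \<le> n" "I \<subseteq> {1..n}" "in_span x j (after j \<union> I)"
  shows "insert (XVar j) (YVar ` I) \<in> enbc_nonfaces"
proof -
  have "finite I" using assms(2) finite_subset by blast
  then show ?thesis using assms rk_upset_eq_iff[of j I] unfolding enbc_nonfaces_def by blast
qed

lemma finite_enbc_nonface:
  assumes "A \<in> enbc_nonfaces"
  shows "finite A" "A \<subseteq> bivars n"
proof -
  have "A \<subseteq> bivars n"
    using assms
  proof (cases rule: enbc_nonface_cases)
    case (broken C)
    then show ?thesis using circuit_properties(4)[OF broken(1)] by (auto simp: bivars_def)
  next
    case (spanned j I)
    then show ?thesis by (auto simp: bivars_def)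
  qed
  moreover have "finite (bivars n)" by (simp add: bivars_def)
  ultimately show "finite A" "A \<subseteq> bivars n" using finite_subset by blast+
qed

text \<open>If \<open>A\<close> is a face, it lies in the facet of the set \<open>F\<close> of its nonzero \<open>y\<close>-indices, since a larger \<open>F\<close>
  only spans more and so leaves a smaller \<open>L(F) - F\<close>.  Hence \<open>A\<close> is a nonface exactly if \<open>F\<close> contains a
  broken circuit or some \<open>x\<close>-index of \<open>A\<close> is spanned by later indices and \<open>F\<close>.\<close>

lemma not_in_enbc_complex_iff:
  assumes A: "A \<subseteq> bivars n"
  shows "A \<notin> enbc_complex n x P \<longleftrightarrow> (\<exists>B\<in>enbc_nonfaces. B \<subseteq> A)"
proof
  assume nA: "A \<notin> enbc_complex n x P"
  define F where "F = {i. YVar i \<in> A \<and> i \<noteq> 0}"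
  have F: "F \<subseteq> {1..n}" "0 \<notin> F" using A by (auto simp: F_def bivars_def Suc_le_eq)
  show "\<exists>B\<in>enbc_nonfaces. B \<subseteq> A"
  proof (cases "F \<in> nbc_complex n x")
    case False
    then obtain B where "broken_circuit n x B" "B \<subseteq> F"
      using F unfolding nbc_complex_def by auto
    then show ?thesis unfolding enbc_nonfaces_def F_def by blast
  next
    case True
    then have "F \<in> rnbc_complex n x" using F unfolding rnbc_complex_def by blast
    then have "\<not> A \<subseteq> enbc_facet n x P F" using nA unfolding enbc_complex_def by blast
    then obtain w where w: "w \<in> A" "w \<notin> enbc_facet n x P F" by blast
    then obtain j where j: "w = XVar j" "j \<notin> lex_basis n x P F - F"
      by (cases w) (auto simp: enbc_facet_def F_def)
    have jn: "j \<le> n" using w(1) j(1) A by (auto simp: bivars_def)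
    have "F \<subseteq> {..n}" using F by auto
    then have "in_span x j (after j \<union> F)" using j(2) jn lex_basis_minus by blast
    then have "insert (XVar j) (YVar ` F) \<in> enbc_nonfaces" using jn F by (intro enbc_nonfacesI)
    moreover have "insert (XVar j) (YVar ` F) \<subseteq> A" using w(1) j(1) by (auto simp: F_def)
    ultimately show ?thesis by blast
  qed
next
  assume "\<exists>B\<in>enbc_nonfaces. B \<subseteq> A"
  then obtain B where B: "B \<in> enbc_nonfaces" "B \<subseteq> A" by blast
  show "A \<notin> enbc_complex n x P"
  proof
    assume "A \<in> enbc_complex n x P"
    then obtain F where F: "F \<in> nbc_complex n x" and AF: "A \<subseteq> enbc_facet n x P F"
      unfolding enbc_complex_def rnbc_complex_def by blast
    have Fn: "F \<subseteq> {..n}" using F unfolding nbc_complex_def by blast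
    then have finF: "finite F" using finite_subset by blast
    have yF: "i \<in> F" if "YVar i \<in> B" "i \<ge> 1" for i
      using that B(2) AF by (auto simp: enbc_facet_def)
    show False
      using B(1)
    proof (cases rule: enbc_nonface_cases)
      case (broken C)
      then have bc: "broken_circuit n x (C - {Min C})" unfolding broken_circuit_def by blast
      have "C - {Min C} \<subseteq> F"
      proof
        fix k assume k: "k \<in> C - {Min C}"
        then have "k \<ge> 1" using broken_circuit_subset[OF bc] by auto
        moreover have "YVar k \<in> B" unfolding broken(2) using k by (rule imageI)
        ultimately show "k \<in> F" using yF by simp
      qed
      then show False using F bc unfolding nbc_complex_def by blast
    next
      case (spanned j I)
      then have "I \<subseteq> F" using yF by auto
      then have "in_span x j (after j \<union> F)"
        using in_span_mono[OF spanned(3)] finF finite_after by blast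
      moreover have "j \<in> lex_basis n x P F - F"
        using spanned(4) B(2) AF by (auto simp: enbc_facet_def)
      ultimately show False using lex_basis_minus[OF Fn] by blast
    qed
  qed
qed

end


section \<open>Ideals of the bihomogeneous coordinate ring\<close>

lemma coord_ring_simps [simp]:
  "f \<in> carrier (coord_ring n) \<longleftrightarrow> Poly_Mapping.keys f \<subseteq> monomials n"
  "monoid.mult (coord_ring n) = (*)" "monoid.one (coord_ring n) = 1"
  "ring.zero (coord_ring n) = 0" "ring.add (coord_ring n) = (+)"
  by (simp_all add: coord_ring_def)

abbreviation poly_ideal :: "nat \<Rightarrow> 'k::field bipoly set \<Rightarrow> bool" where
  "poly_ideal n I \<equiv> ideal I (coord_ring n)"

lemma keys_mult_monomials:
  assumes "Poly_Mapping.keys f \<subseteq> monomials n" "Poly_Mapping.keys g \<subseteq> monomials n"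
  shows "Poly_Mapping.keys (f * g) \<subseteq> monomials n"
proof
  fix m assume "m \<in> Poly_Mapping.keys (f * g)"
  then obtain s t where "m = s + t" "s \<in> Poly_Mapping.keys f" "t \<in> Poly_Mapping.keys g"
    using Poly_Mapping.keys_mult[of f g] by blast
  then show "m \<in> monomials n" using assms monomials_add by blast
qed

lemma poly_idealI:
  fixes I :: "'k::field bipoly set"
  assumes sub: "\<And>f. f \<in> I \<Longrightarrow> Poly_Mapping.keys f \<subseteq> monomials n" and zero: "0 \<in> I"
    and add: "\<And>f g. f \<in> I \<Longrightarrow> g \<in> I \<Longrightarrow> f + g \<in> I"
    and mult: "\<And>c f. Poly_Mapping.keys c \<subseteq> monomials n \<Longrightarrow> f \<in> I \<Longrightarrow> c * f \<in> I"
  shows "poly_ideal n I"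
proof -
  interpret R: cring "coord_ring n :: 'k bipoly ring" by (rule cring_coord_ring)
  show ?thesis
  proof (rule idealI[OF R.ring_axioms])
    show "subgroup I (add_monoid (coord_ring n))"
    proof (rule group.subgroupI[OF R.add.is_group])
      show "I \<subseteq> carrier (add_monoid (coord_ring n))" using sub by auto
      show "I \<noteq> {}" using zero by blast
      fix f assume f: "f \<in> I"
      have "- f \<in> I" using mult[OF _ f, of "- 1"] by (simp add: monomials_0)
      moreover have "inv\<^bsub>add_monoid (coord_ring n)\<^esub> f = - f"
        unfolding a_inv_def[symmetric]
        by (rule R.add.inv_equality) (use sub[OF f] in simp_all)
      ultimately show "inv\<^bsub>add_monoid (coord_ring n)\<^esub> f \<in> I" by simp
    qed (use add in simp)
    fix f c :: "'k bipoly" assume "f \<in> I" "c \<in> carrier (coord_ring n)"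
    then show "c \<otimes>\<^bsub>coord_ring n\<^esub> f \<in> I" "f \<otimes>\<^bsub>coord_ring n\<^esub> c \<in> I"
      using mult[of c f] by (simp_all add: mult.commute[of f c])
  qed
qed

context
  fixes n :: nat and I :: "'k::field bipoly set"
  assumes I: "poly_ideal n I"
begin

lemma poly_ideal_subset: "f \<in> I \<Longrightarrow> Poly_Mapping.keys f \<subseteq> monomials n"
  using ideal.Icarr[OF I] by simp

lemma poly_ideal_add: "f \<in> I \<Longrightarrow> g \<in> I \<Longrightarrow> f + g \<in> I"
  using additive_subgroup.a_closed[OF ideal.axioms(1)[OF I]] by simp

lemma poly_ideal_zero: "0 \<in> I"
  using additive_subgroup.zero_closed[OF ideal.axioms(1)[OF I]] by simp

lemma poly_ideal_mult: "Poly_Mapping.keys c \<subseteq> monomials n \<Longrightarrow> f \<in> I \<Longrightarrow> c * f \<in> I"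
  using ideal.I_l_closed[OF I, of f c] by simp

lemma poly_ideal_uminus: "f \<in> I \<Longrightarrow> - f \<in> I"
  using poly_ideal_mult[of "- 1" f] by (simp add: monomials_0)

lemma poly_ideal_diff: "f \<in> I \<Longrightarrow> g \<in> I \<Longrightarrow> f - g \<in> I"
  using poly_ideal_add[of f "- g"] poly_ideal_uminus[of g] by simp

lemma poly_ideal_sum: "(\<And>i. i \<in> A \<Longrightarrow> f i \<in> I) \<Longrightarrow> (\<Sum>i\<in>A. f i) \<in> I"
  by (induction A rule: infinite_finite_induct) (simp_all add: poly_ideal_zero poly_ideal_add)

end

lemma genideal_poly:
  fixes G :: "'k::field bipoly set"
  assumes "\<And>g. g \<in> G \<Longrightarrow> Poly_Mapping.keys g \<subseteq> monomials n"
  shows "poly_ideal n (Idl\<^bsub>coord_ring n\<^esub> G)" "G \<subseteq> Idl\<^bsub>coord_ring n\<^esub> G"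
    and "poly_ideal n I \<Longrightarrow> G \<subseteq> I \<Longrightarrow> Idl\<^bsub>coord_ring n\<^esub> G \<subseteq> I"
proof -
  interpret R: cring "coord_ring n :: 'k bipoly ring" by (rule cring_coord_ring)
  have G: "G \<subseteq> carrier (coord_ring n)" using assms by auto
  show "poly_ideal n (Idl\<^bsub>coord_ring n\<^esub> G)" by (rule R.genideal_ideal[OF G])
  show "G \<subseteq> Idl\<^bsub>coord_ring n\<^esub> G" by (rule R.genideal_self[OF G])
  show "poly_ideal n I \<Longrightarrow> G \<subseteq> I \<Longrightarrow> Idl\<^bsub>coord_ring n\<^esub> G \<subseteq> I" by (rule R.genideal_minimal)
qed


lemma keys_diff_subset:
  fixes f g :: "'a \<Rightarrow>\<^sub>0 'b::ab_group_add"
  shows "Poly_Mapping.keys (f - g) \<subseteq> Poly_Mapping.keys f \<union> Poly_Mapping.keys g"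
  by (auto simp: in_keys_iff lookup_minus)

lemma keys_pterm [simp]: "Poly_Mapping.keys (pterm m :: 'k::field bipoly) = {m}"
  by (simp add: pterm_def)

lemma pconst_mult_pterm: "pconst c * pterm m = Poly_Mapping.single m c"
  by (simp add: pconst_def pterm_def mult_single)

lemma pterm_add: "pterm (s + t) = (pterm s * pterm t :: 'k::field bipoly)"
  by (simp add: pterm_def mult_single)

lemma poly_expansion:
  fixes f :: "'k::field bipoly"
  shows "f = (\<Sum>m\<in>Poly_Mapping.keys f. pconst (Poly_Mapping.lookup f m) * pterm m)"
proof (rule poly_mapping_eqI)
  fix m
  have "Poly_Mapping.lookup f m = (\<Sum>m'\<in>Poly_Mapping.keys f. if m' = m then Poly_Mapping.lookup f m else 0)"
    by (simp add: in_keys_iff)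
  also have "\<dots> = (\<Sum>m'\<in>Poly_Mapping.keys f. Poly_Mapping.lookup (Poly_Mapping.single m' (Poly_Mapping.lookup f m')) m)"
    by (rule sum.cong[OF refl]) (auto simp: lookup_single when_def)
  finally show "Poly_Mapping.lookup f m =
      Poly_Mapping.lookup (\<Sum>m\<in>Poly_Mapping.keys f. pconst (Poly_Mapping.lookup f m) * pterm m) m"
    by (simp add: lookup_sum pconst_mult_pterm)
qed

section \<open>Squarefree monomials\<close>

definition squarefree_monomial :: "var set \<Rightarrow> monomial" where
  "squarefree_monomial A = (\<Sum>v\<in>A. mvar v)"

lemma lookup_mvar: "Poly_Mapping.lookup (mvar v) w = (if v = w then 1 else 0)"
  by (simp add: mvar_def lookup_single when_def)

lemma lookup_squarefree_monomial:
  "finite A \<Longrightarrow> Poly_Mapping.lookup (squarefree_monomial A) v = (if v \<in> A then 1 else 0)"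
  by (simp add: squarefree_monomial_def lookup_sum lookup_mvar)

lemma keys_squarefree_monomial: "finite A \<Longrightarrow> Poly_Mapping.keys (squarefree_monomial A) = A"
  by (auto simp: in_keys_iff lookup_squarefree_monomial split: if_splits)

lemma pterm_squarefree_monomial:
  "pterm (squarefree_monomial A) = (\<Prod>v\<in>A. pvar v :: 'k::field bipoly)"
proof -
  have "pterm 0 = (1 :: 'k bipoly)" by (simp add: pterm_def)
  then show ?thesis unfolding squarefree_monomial_def
    by (induction A rule: infinite_finite_induct) (simp_all add: pterm_add pvar_def)
qed

lemma squarefree_monomial_dvd:
  assumes "finite A" "A \<subseteq> Poly_Mapping.keys m"
  shows "m = squarefree_monomial A + (m - squarefree_monomial A)"
proof (rule poly_mapping_eqI)
  fix v
  have "Poly_Mapping.lookup m v \<ge> 1" if "v \<in> A" using that assms(2) by (auto simp: in_keys_iff Suc_le_eq)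
  then show "Poly_Mapping.lookup m v = Poly_Mapping.lookup (squarefree_monomial A + (m - squarefree_monomial A)) v"
    using assms(1) by (simp add: lookup_add lookup_minus lookup_squarefree_monomial)
qed

lemma monomials_iff: "m \<in> monomials n \<longleftrightarrow> Poly_Mapping.keys m \<subseteq> bivars n"
  by (simp add: monomials_def)

lemma monomials_minus: "m \<in> monomials n \<Longrightarrow> m - t \<in> monomials n"
  by (auto simp: monomials_iff in_keys_iff lookup_minus)

lemma finite_bivars: "finite (bivars n)"
  by (simp add: bivars_def)

lemma mdegree_superset:
  assumes "finite S" "Poly_Mapping.keys m \<subseteq> S"
  shows "mdegree m = (\<Sum>v\<in>S. Poly_Mapping.lookup m v)"
  unfolding mdegree_def
  by (rule sum.mono_neutral_left) (use assms in \<open>auto simp: in_keys_iff\<close>)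

lemma mdegree_add: "mdegree (s + t) = mdegree s + mdegree t"
proof -
  let ?S = "Poly_Mapping.keys s \<union> Poly_Mapping.keys t"
  have "Poly_Mapping.keys (s + t) \<subseteq> ?S" by (rule Poly_Mapping.keys_add)
  then show ?thesis
    by (simp add: mdegree_superset[of ?S] lookup_add sum.distrib)
qed


lemma mdegree_mvar: "mdegree (mvar v) = 1"
  by (simp add: mdegree_def mvar_def)

text \<open>The relations used for reduction are homogeneous, so this finiteness is what makes the reduction
  end.\<close>

lemma finite_monomials_of_degree: "finite {m \<in> monomials n. mdegree m = d}"
proof (rule finite_imageD)
  let ?M = "{m \<in> monomials n. mdegree m = d}"
  have "Poly_Mapping.lookup ` ?M \<subseteq> {f. \<forall>v. (v \<in> bivars n \<longrightarrow> f v \<in> {..d}) \<and> (v \<notin> bivars n \<longrightarrow> f v = 0)}"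
  proof (intro image_subsetI CollectI allI)
    fix m v assume m: "m \<in> ?M"
    have K: "Poly_Mapping.keys m \<subseteq> bivars n" using m by (simp add: monomials_iff)
    have "Poly_Mapping.lookup m v \<le> d" if "v \<in> bivars n"
      using member_le_sum[OF that, of "Poly_Mapping.lookup m"] m mdegree_superset[OF finite_bivars K]
      by (simp add: finite_bivars)
    moreover have "Poly_Mapping.lookup m v = 0" if "v \<notin> bivars n" using that K by (auto simp: in_keys_iff)
    ultimately show "(v \<in> bivars n \<longrightarrow> Poly_Mapping.lookup m v \<in> {..d}) \<and>
        (v \<notin> bivars n \<longrightarrow> Poly_Mapping.lookup m v = 0)" by simp
  qed
  moreover have "finite {f. \<forall>v. (v \<in> bivars n \<longrightarrow> f v \<in> {..d}) \<and> (v \<notin> bivars n \<longrightarrow> f v = 0)}"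
    by (rule finite_set_of_finite_funs) (simp_all add: finite_bivars)
  ultimately show "finite (Poly_Mapping.lookup ` ?M)" by (rule finite_subset)
  show "inj_on Poly_Mapping.lookup ?M" by (rule inj_onI) (rule poly_mapping_eqI, simp)
qed


section \<open>Evaluation at points\<close>

definition coordinate :: "'k::field geom_vec \<times> 'k geom_vec \<Rightarrow> var \<Rightarrow> 'k alg_closure" where
  "coordinate p v = (case v of XVar i \<Rightarrow> fst p i | YVar i \<Rightarrow> snd p i)"

definition mono_eval :: "monomial \<Rightarrow> 'k::field geom_vec \<times> 'k geom_vec \<Rightarrow> 'k alg_closure" where
  "mono_eval m p = (\<Prod>v\<in>Poly_Mapping.keys m. coordinate p v ^ Poly_Mapping.lookup m v)"

lemma bieval_eq:
  "bieval f p = (\<Sum>m\<in>Poly_Mapping.keys f. to_ac (Poly_Mapping.lookup f m) * mono_eval m p)"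
  by (simp add: bieval_def mono_eval_def coordinate_def)

lemma mono_eval_superset:
  assumes "finite S" "Poly_Mapping.keys m \<subseteq> S"
  shows "mono_eval m p = (\<Prod>v\<in>S. coordinate p v ^ Poly_Mapping.lookup m v)"
  unfolding mono_eval_def
  by (rule prod.mono_neutral_left) (use assms in \<open>auto simp: in_keys_iff\<close>)

lemma mono_eval_add: "mono_eval (s + t) p = mono_eval s p * mono_eval t p"
proof -
  let ?S = "Poly_Mapping.keys s \<union> Poly_Mapping.keys t"
  have "Poly_Mapping.keys (s + t) \<subseteq> ?S" by (rule Poly_Mapping.keys_add)
  then show ?thesis
    by (simp add: mono_eval_superset[of ?S] lookup_add power_add prod.distrib)
qed

lemma bieval_superset:
  assumes "finite S" "Poly_Mapping.keys f \<subseteq> S"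
  shows "bieval f p = (\<Sum>m\<in>S. to_ac (Poly_Mapping.lookup f m) * mono_eval m p)"
  unfolding bieval_eq
  by (rule sum.mono_neutral_left) (use assms in \<open>auto simp: in_keys_iff\<close>)

lemma bieval_zero [simp]: "bieval 0 p = 0"
  by (simp add: bieval_eq)

lemma bieval_add [simp]: "bieval (f + g) p = bieval f p + bieval g p"
proof -
  let ?S = "Poly_Mapping.keys f \<union> Poly_Mapping.keys g"
  have "Poly_Mapping.keys (f + g) \<subseteq> ?S" by (rule Poly_Mapping.keys_add)
  then show ?thesis
    by (simp add: bieval_superset[of ?S] lookup_add distrib_right sum.distrib)
qed

lemma bieval_sum [simp]: "bieval (\<Sum>i\<in>A. f i) p = (\<Sum>i\<in>A. bieval (f i) p)"
  by (induction A rule: infinite_finite_induct) simp_all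

lemma bieval_single: "bieval (Poly_Mapping.single m c) p = to_ac c * mono_eval m p"
  by (simp add: bieval_eq)

lemma bieval_mult [simp]: "bieval (f * g) p = bieval f p * bieval g p"
proof -
  let ?s = "\<lambda>(h::'a bipoly) m. Poly_Mapping.single m (Poly_Mapping.lookup h m)"
  have exp: "h = (\<Sum>m\<in>Poly_Mapping.keys h. ?s h m)" for h :: "'a bipoly"
    using poly_expansion[of h] by (simp add: pconst_mult_pterm)
  have "f * g = (\<Sum>s\<in>Poly_Mapping.keys f. \<Sum>t\<in>Poly_Mapping.keys g. ?s f s * ?s g t)"
    by (subst exp[of f], subst exp[of g]) (simp add: sum_product)
  then show ?thesis
    by (simp add: mult_single bieval_single mono_eval_add sum_product bieval_eq[of f] bieval_eq[of g] mult_ac)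
qed

lemma bieval_one [simp]: "bieval 1 p = 1"
  by (simp add: bieval_eq mono_eval_def)

lemma bieval_uminus [simp]: "bieval (- f) p = - bieval f p"
  using bieval_add[of f "- f" p] by (simp add: eq_neg_iff_add_eq_0 add.commute del: bieval_add)

lemma bieval_diff [simp]: "bieval (f - g) p = bieval f p - bieval g p"
  using bieval_add[of f "- g" p] by simp

lemma bieval_prod [simp]: "bieval (\<Prod>i\<in>A. f i) p = (\<Prod>i\<in>A. bieval (f i) p)"
  by (induction A rule: infinite_finite_induct) simp_all

lemma bieval_pconst [simp]: "bieval (pconst c) p = to_ac c"
  by (simp add: pconst_def bieval_single mono_eval_def)

lemma bieval_pvar [simp]: "bieval (pvar v) p = coordinate p v"
  by (simp add: pvar_def pterm_def bieval_single mono_eval_def mvar_def)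

definition vanishing_ideal :: "nat \<Rightarrow> ('k::field geom_vec \<times> 'k geom_vec) set \<Rightarrow> 'k bipoly set" where
  "vanishing_ideal n A = {f. Poly_Mapping.keys f \<subseteq> monomials n \<and> (\<forall>p\<in>A. bieval f p = 0)}"

lemma poly_ideal_vanishing_ideal: "poly_ideal n (vanishing_ideal n A)"
proof (rule poly_idealI)
  fix f g assume "f \<in> vanishing_ideal n A" "g \<in> vanishing_ideal n A"
  then show "f + g \<in> vanishing_ideal n A"
    using Poly_Mapping.keys_add[of f g] by (auto simp: vanishing_ideal_def)
qed (auto simp: vanishing_ideal_def dest: subsetD[OF keys_mult_monomials, rotated 2])


section \<open>Reduction to standard monomials\<close>

locale monomial_order =
  fixes n :: nat and T :: "monomial rel"
  assumes T: "term_order n T"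
begin

lemma T_order:
  shows "(s, t) \<in> T \<Longrightarrow> s \<in> monomials n \<and> t \<in> monomials n"
    and "s \<in> monomials n \<Longrightarrow> (s, s) \<in> T"
    and "(s, t) \<in> T \<Longrightarrow> (t, u) \<in> T \<Longrightarrow> (s, u) \<in> T"
    and "(s, t) \<in> T \<Longrightarrow> (t, s) \<in> T \<Longrightarrow> s = t"
    and "s \<in> monomials n \<Longrightarrow> t \<in> monomials n \<Longrightarrow> (s, t) \<in> T \<or> (t, s) \<in> T"
    and "u \<in> monomials n \<Longrightarrow> (s, t) \<in> T \<Longrightarrow> (s + u, t + u) \<in> T"
proof -
  have facts: "T \<subseteq> monomials n \<times> monomials n" "refl_on (monomials n) T" "trans T" "antisym T"
      "total_on (monomials n) T"
    using T by (simp_all add: term_order_def order_on_defs)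
  show "(s, t) \<in> T \<Longrightarrow> s \<in> monomials n \<and> t \<in> monomials n" using facts(1) by auto
  show refl: "s \<in> monomials n \<Longrightarrow> (s, s) \<in> T" using facts(2) by (simp add: refl_on_def)
  show "(s, t) \<in> T \<Longrightarrow> (t, u) \<in> T \<Longrightarrow> (s, u) \<in> T" by (rule transD[OF facts(3)])
  show "(s, t) \<in> T \<Longrightarrow> (t, s) \<in> T \<Longrightarrow> s = t" by (rule antisymD[OF facts(4)])
  show "s \<in> monomials n \<Longrightarrow> t \<in> monomials n \<Longrightarrow> (s, t) \<in> T \<or> (t, s) \<in> T"
    using facts(5) refl by (cases "s = t") (auto simp: total_on_def)
  show "u \<in> monomials n \<Longrightarrow> (s, t) \<in> T \<Longrightarrow> (s + u, t + u) \<in> T"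
    using T by (simp add: term_order_def)
qed

lemma init_term_eqI:
  assumes "m \<in> Poly_Mapping.keys f" "\<And>m'. m' \<in> Poly_Mapping.keys f \<Longrightarrow> (m', m) \<in> T"
  shows "init_term T f = m"
  unfolding init_term_def by (rule the_equality) (use assms T_order(4) in blast)+

lemma finite_has_T_maximum:
  assumes "finite K" "K \<noteq> {}" "K \<subseteq> monomials n"
  shows "\<exists>m\<in>K. \<forall>m'\<in>K. (m', m) \<in> T"
  using assms
proof (induction K rule: finite_ne_induct)
  case (singleton m)
  then show ?case using T_order(2) by simp
next
  case (insert k K)
  then obtain m where m: "m \<in> K" "\<forall>m'\<in>K. (m', m) \<in> T" by auto
  have "k \<in> monomials n" "m \<in> monomials n" using insert.prems m by auto
  then consider "(k, m) \<in> T" | "(m, k) \<in> T" "(k, k) \<in> T" using T_order(2,5) by blast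
  then show ?case
  proof cases
    case 1
    then show ?thesis using m by auto
  next
    case 2
    then have "\<forall>m'\<in>insert k K. (m', k) \<in> T" using m T_order(3) by blast
    then show ?thesis by blast
  qed
qed

lemma init_term_max:
  assumes "f \<noteq> 0" "Poly_Mapping.keys f \<subseteq> monomials n"
  shows "init_term T f \<in> Poly_Mapping.keys f"
    and "m \<in> Poly_Mapping.keys f \<Longrightarrow> (m, init_term T f) \<in> T"
proof -
  have "Poly_Mapping.keys f \<noteq> {}" using assms(1) by simp
  then obtain m0 where "m0 \<in> Poly_Mapping.keys f" "\<forall>m'\<in>Poly_Mapping.keys f. (m', m0) \<in> T"
    using finite_has_T_maximum[of "Poly_Mapping.keys f"] assms(2) by auto
  moreover from this have "init_term T f = m0" by (intro init_term_eqI) auto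
  ultimately show "init_term T f \<in> Poly_Mapping.keys f" "m \<in> Poly_Mapping.keys f \<Longrightarrow> (m, init_term T f) \<in> T"
    by auto
qed

end

text \<open>Every monomial that satisfies \<open>red\<close> is the leading monomial of an element of \<open>J\<close> that is
  homogeneous in the total degree.\<close>

locale homogeneous_reduction = monomial_order n T for n T +
  fixes J :: "'k::field bipoly set" and red :: "monomial \<Rightarrow> bool"
  assumes J: "poly_ideal n J"
    and rule: "\<And>m. m \<in> monomials n \<Longrightarrow> red m \<Longrightarrow> \<exists>f\<in>J. Poly_Mapping.lookup f m = 1 \<and>
                 (\<forall>h\<in>Poly_Mapping.keys f. mdegree h = mdegree m \<and> (h, m) \<in> T)"
begin

text \<open>Subtracting the rule for \<open>m\<close> leaves smaller monomials of the same degree.  That an irreducible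
  monomial stays as it is will be needed to follow the leading term through the reduction.\<close>

lemma monomial_normal_form:
  assumes "m \<in> monomials n"
  shows "\<exists>h. pterm m - h \<in> J \<and> (\<forall>s\<in>Poly_Mapping.keys h. s \<in> monomials n \<and> \<not> red s \<and> (s, m) \<in> T)
           \<and> (\<not> red m \<longrightarrow> h = pterm m)"
  using assms
proof (induction "card {s \<in> monomials n. mdegree s = mdegree m \<and> (s, m) \<in> T}" arbitrary: m rule: less_induct)
  case less
  show ?case
  proof (cases "red m")
    case False
    then show ?thesis
      using less.prems poly_ideal_zero[OF J] T_order(2) by (intro exI[of _ "pterm m"]) simp
  next
    case True
    then obtain f where f: "f \<in> J" "Poly_Mapping.lookup f m = 1"
        "\<And>h. h \<in> Poly_Mapping.keys f \<Longrightarrow> mdegree h = mdegree m \<and> (h, m) \<in> T"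
      using rule[OF less.prems] by blast
    let ?K = "Poly_Mapping.keys f - {m}"
    have smaller: "\<exists>h. pterm k - h \<in> J \<and> (\<forall>s\<in>Poly_Mapping.keys h. s \<in> monomials n \<and> \<not> red s \<and> (s, k) \<in> T)"
      if k: "k \<in> ?K" for k
    proof -
      let ?D = "\<lambda>m. {s \<in> monomials n. mdegree s = mdegree m \<and> (s, m) \<in> T}"
      have km: "(k, m) \<in> T" "k \<noteq> m" "mdegree k = mdegree m" and kM: "k \<in> monomials n"
        using k f(3)[of k] T_order(1)[of k m] by auto
      have "?D k \<subset> ?D m"
      proof
        show "?D k \<subseteq> ?D m" using km T_order(3)[OF _ km(1)] by auto
        have "m \<in> ?D m" using less.prems T_order(2) by simp
        moreover have "m \<notin> ?D k" using km T_order(4) by blast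
        ultimately show "?D k \<noteq> ?D m" by blast
      qed
      moreover have "finite (?D m)"
        by (rule finite_subset[OF _ finite_monomials_of_degree[of n "mdegree m"]]) auto
      ultimately have "card (?D k) < card (?D m)" by (intro psubset_card_mono)
      from less.hyps[OF this kM] show ?thesis by blast
    qed
    then obtain h where h: "\<And>k. k \<in> ?K \<Longrightarrow> pterm k - h k \<in> J"
        "\<And>k s. k \<in> ?K \<Longrightarrow> s \<in> Poly_Mapping.keys (h k) \<Longrightarrow> s \<in> monomials n \<and> \<not> red s \<and> (s, k) \<in> T"
      by metis
    define c where "c k = pconst (Poly_Mapping.lookup f k)" for k
    define H where "H = - (\<Sum>k\<in>?K. c k * h k)"
    have "m \<in> Poly_Mapping.keys f" using f(2) by (simp add: in_keys_iff)
    then have "(\<Sum>k\<in>Poly_Mapping.keys f. c k * pterm k) = c m * pterm m + (\<Sum>k\<in>?K. c k * pterm k)"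
      by (simp add: sum.remove)
    moreover have "c m = 1" using f(2) by (simp add: c_def pconst_def)
    moreover have "(\<Sum>k\<in>Poly_Mapping.keys f. c k * pterm k) = f"
      unfolding c_def by (rule poly_expansion[symmetric])
    ultimately have "pterm m = f - (\<Sum>k\<in>?K. c k * pterm k)" by (simp add: eq_diff_eq)
    then have diff: "pterm m - H = f - (\<Sum>k\<in>?K. c k * (pterm k - h k))"
      by (simp add: H_def right_diff_distrib sum_subtractf)
    have in_J: "c k * (pterm k - h k) \<in> J" if "k \<in> ?K" for k
      by (rule poly_ideal_mult[OF J _ h(1)[OF that]]) (simp add: c_def pconst_def monomials_0)
    have "pterm m - H \<in> J"
      unfolding diff by (rule poly_ideal_diff[OF J f(1) poly_ideal_sum[OF J in_J]])
    moreover have "s \<in> monomials n \<and> \<not> red s \<and> (s, m) \<in> T" if s: "s \<in> Poly_Mapping.keys H" for s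
    proof -
      have "s \<in> Poly_Mapping.keys (\<Sum>k\<in>?K. c k * h k)" using s by (simp add: H_def in_keys_iff)
      then obtain k where k: "k \<in> ?K" "s \<in> Poly_Mapping.keys (c k * h k)"
        using Poly_Mapping.keys_sum[of "\<lambda>k. c k * h k" ?K] by blast
      have "s \<in> Poly_Mapping.keys (h k)"
        using k(2) Poly_Mapping.keys_mult[of "c k" "h k"] by (auto simp: c_def pconst_def split: if_splits)
      then show ?thesis using h(2)[OF k(1)] f(3)[of k] k(1) T_order(3) by blast
    qed
    ultimately show ?thesis using True by (intro exI[of _ H]) simp
  qed
qed

text \<open>An irreducible leading term survives in the remainder, because the reductions of the other terms
  contain only monomials smaller than it.\<close>

lemma normal_form:
  assumes f: "Poly_Mapping.keys f \<subseteq> monomials n"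
  obtains g where "f - g \<in> J" "\<And>s. s \<in> Poly_Mapping.keys g \<Longrightarrow> s \<in> monomials n \<and> \<not> red s"
    "f \<noteq> 0 \<Longrightarrow> \<not> red (init_term T f) \<Longrightarrow> g \<noteq> 0"
proof -
  have "\<forall>m. \<exists>h. m \<in> Poly_Mapping.keys f \<longrightarrow> pterm m - h \<in> J \<and>
      (\<forall>s\<in>Poly_Mapping.keys h. s \<in> monomials n \<and> \<not> red s \<and> (s, m) \<in> T) \<and> (\<not> red m \<longrightarrow> h = pterm m)"
    using monomial_normal_form[OF subsetD[OF f]] by simp
  then obtain h where "\<forall>m. m \<in> Poly_Mapping.keys f \<longrightarrow> pterm m - h m \<in> J \<and>
      (\<forall>s\<in>Poly_Mapping.keys (h m). s \<in> monomials n \<and> \<not> red s \<and> (s, m) \<in> T) \<and> (\<not> red m \<longrightarrow> h m = pterm m)"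
    by (drule_tac choice) blast
  then have h: "\<And>m. m \<in> Poly_Mapping.keys f \<Longrightarrow> pterm m - h m \<in> J"
      "\<And>m s. m \<in> Poly_Mapping.keys f \<Longrightarrow> s \<in> Poly_Mapping.keys (h m) \<Longrightarrow> s \<in> monomials n \<and> \<not> red s \<and> (s, m) \<in> T"
      "\<And>m. m \<in> Poly_Mapping.keys f \<Longrightarrow> \<not> red m \<Longrightarrow> h m = pterm m"
    by simp_all
  define c where "c k = pconst (Poly_Mapping.lookup f k)" for k
  define g where "g = (\<Sum>k\<in>Poly_Mapping.keys f. c k * h k)"
  have ch: "Poly_Mapping.lookup (c k * h k) s = Poly_Mapping.lookup f k * Poly_Mapping.lookup (h k) s" for k s
  proof -
    have "Poly_Mapping.lookup (c k * h k) s = Poly_Mapping.lookup (Poly_Mapping.map ((*) (Poly_Mapping.lookup f k)) (h k)) s"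
      by (simp add: mult_map_scale_conv_mult c_def pconst_def)
    then show ?thesis by (simp add: Poly_Mapping.map.rep_eq when_def)
  qed
  have "(\<Sum>k\<in>Poly_Mapping.keys f. c k * pterm k) = f"
    unfolding c_def by (rule poly_expansion[symmetric])
  then have diff: "f - g = (\<Sum>k\<in>Poly_Mapping.keys f. c k * (pterm k - h k))"
    by (simp add: g_def right_diff_distrib sum_subtractf)
  have in_J: "c k * (pterm k - h k) \<in> J" if "k \<in> Poly_Mapping.keys f" for k
    by (rule poly_ideal_mult[OF J _ h(1)[OF that]]) (simp add: c_def pconst_def monomials_0)
  have 1: "f - g \<in> J" unfolding diff by (rule poly_ideal_sum[OF J in_J])
  have 2: "s \<in> monomials n \<and> \<not> red s" if s: "s \<in> Poly_Mapping.keys g" for s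
  proof -
    obtain k where k: "k \<in> Poly_Mapping.keys f" "s \<in> Poly_Mapping.keys (c k * h k)"
      using s Poly_Mapping.keys_sum[of "\<lambda>k. c k * h k" "Poly_Mapping.keys f"] unfolding g_def by blast
    then have "s \<in> Poly_Mapping.keys (h k)" by (auto simp: in_keys_iff ch)
    then show ?thesis using h(2)[OF k(1)] by blast
  qed
  have 3: "g \<noteq> 0" if "f \<noteq> 0" "\<not> red (init_term T f)"
  proof -
    let ?m = "init_term T f"
    note max = init_term_max[OF that(1) f]
    have "Poly_Mapping.lookup (h k) ?m = 0" if k: "k \<in> Poly_Mapping.keys f" "k \<noteq> ?m" for k
    proof (rule ccontr)
      assume "Poly_Mapping.lookup (h k) ?m \<noteq> 0"
      then have "?m \<in> Poly_Mapping.keys (h k)" by (simp add: in_keys_iff)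
      then have "(?m, k) \<in> T" using h(2)[OF k(1)] by blast
      then show False using max(2)[OF k(1)] k(2) T_order(4) by blast
    qed
    moreover have "Poly_Mapping.lookup (h ?m) ?m = 1"
      using h(3)[OF max(1) that(2)] by (simp add: pterm_def)
    ultimately have "Poly_Mapping.lookup g ?m = (\<Sum>k\<in>Poly_Mapping.keys f. if k = ?m then Poly_Mapping.lookup f ?m else 0)"
      unfolding g_def lookup_sum ch by (intro sum.cong) auto
    also have "\<dots> = Poly_Mapping.lookup f ?m" using max(1) by simp
    finally have "Poly_Mapping.lookup g ?m \<noteq> 0" using max(1) by (simp add: in_keys_iff)
    then show ?thesis by auto
  qed
  from that[OF 1 2 3] show ?thesis by blast
qed

end


section \<open>Functions that are polynomial along lines\<close>

text \<open>Polynomial functions are only ever restricted to lines, where univariate polynomials suffice to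
  show that they vanish.\<close>

definition line_polynomial :: "((nat \<Rightarrow> 'a::field) \<Rightarrow> 'a) \<Rightarrow> bool" where
  "line_polynomial g \<longleftrightarrow> (\<forall>z u. \<exists>q. \<forall>t. g (\<lambda>i. z i + t * u i) = poly q t)"

lemma line_polynomial_const: "line_polynomial (\<lambda>z. c)"
  unfolding line_polynomial_def by (intro allI exI[of _ "[:c:]"]) simp

lemma line_polynomial_coord: "line_polynomial (\<lambda>z. z i)"
  unfolding line_polynomial_def
proof (intro allI)
  fix z u :: "nat \<Rightarrow> 'a"
  show "\<exists>q. \<forall>t. z i + t * u i = poly q t" by (intro exI[of _ "[:z i, u i:]"]) simp
qed

lemma line_polynomial_add:
  assumes "line_polynomial f" "line_polynomial g"
  shows "line_polynomial (\<lambda>z. f z + g z)"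
  using assms unfolding line_polynomial_def by (metis poly_add)

lemma line_polynomial_mult:
  assumes "line_polynomial f" "line_polynomial g"
  shows "line_polynomial (\<lambda>z. f z * g z)"
  using assms unfolding line_polynomial_def by (metis poly_mult)

lemma line_polynomial_power:
  assumes "line_polynomial f"
  shows "line_polynomial (\<lambda>z. f z ^ k)"
  using assms unfolding line_polynomial_def by (metis poly_power)

lemma line_polynomial_sum:
  assumes "\<And>i. i \<in> A \<Longrightarrow> line_polynomial (f i)"
  shows "line_polynomial (\<lambda>z. \<Sum>i\<in>A. f i z)"
  using assms
  by (induction A rule: infinite_finite_induct)
     (simp_all add: line_polynomial_const line_polynomial_add)

lemma line_polynomial_prod:
  assumes "\<And>i. i \<in> A \<Longrightarrow> line_polynomial (f i)"
  shows "line_polynomial (\<lambda>z. \<Prod>i\<in>A. f i z)"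
  using assms
  by (induction A rule: infinite_finite_induct)
     (simp_all add: line_polynomial_const line_polynomial_mult)

lemmas line_polynomial_intros = line_polynomial_const line_polynomial_coord line_polynomial_add
  line_polynomial_mult line_polynomial_power line_polynomial_sum line_polynomial_prod

text \<open>Linear subspaces; a nonempty set of this kind contains \<open>0\<close>, by the choice \<open>u = z\<close> and \<open>t = -1\<close>.\<close>

definition line_closed :: "(nat \<Rightarrow> 'a::field) set \<Rightarrow> bool" where
  "line_closed W \<longleftrightarrow> (\<forall>z\<in>W. \<forall>u\<in>W. \<forall>t. (\<lambda>i. z i + t * u i) \<in> W)"

lemma line_closedD: "line_closed W \<Longrightarrow> z \<in> W \<Longrightarrow> u \<in> W \<Longrightarrow> (\<lambda>i. z i + t * u i) \<in> W"
  unfolding line_closed_def by simp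

lemma poly_eq_0_of_cofinite_zeros:
  fixes q :: "'a::field poly"
  assumes "infinite (UNIV :: 'a set)" "finite S" "\<And>t. t \<notin> S \<Longrightarrow> poly q t = 0"
  shows "q = 0"
proof (rule ccontr)
  assume "q \<noteq> 0"
  then have "finite {t. poly q t = 0}" by (rule poly_roots_finite)
  moreover have "UNIV \<subseteq> S \<union> {t. poly q t = 0}" using assms(3) by auto
  ultimately show False using assms(1,2) by (meson finite_UnI finite_subset)
qed

text \<open>The complement of finitely many proper hyperplanes is dense: a line through \<open>z\<close> that lies in none
  of them meets them in finitely many points.  This is what permits dividing identities of polynomial
  functions by coordinates.\<close>

lemma vanishes_of_vanishes_off_hyperplanes:
  fixes W :: "(nat \<Rightarrow> 'a::field) set"
  assumes inf: "infinite (UNIV :: 'a set)" and W: "line_closed W" and g: "line_polynomial g"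
    and S: "finite S" "\<And>k. k \<in> S \<Longrightarrow> \<exists>u\<in>W. u k \<noteq> 0"
    and zero: "\<And>z. z \<in> W \<Longrightarrow> (\<forall>k\<in>S. z k \<noteq> 0) \<Longrightarrow> g z = 0"
    and z: "z \<in> W"
  shows "g z = 0"
proof -
  have "\<forall>z\<in>W. g z = 0" using S zero
  proof (induction S rule: finite_induct)
    case empty
    then show ?case by simp
  next
    case (insert k S)
    have "g z = 0" if z: "z \<in> W" "\<forall>j\<in>S. z j \<noteq> 0" for z
    proof -
      obtain u where u: "u \<in> W" "u k \<noteq> 0" using insert.prems(1) by blast
      obtain q where q: "\<And>t. g (\<lambda>i. z i + t * u i) = poly q t"
        using g unfolding line_polynomial_def by blast
      \<comment> \<open>the parameters at which the line meets one of the hyperplanes\<close>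
      define B where "B = insert (- z k / u k) ((\<lambda>j. - z j / u j) ` S)"
      have "poly q t = 0" if t: "t \<notin> insert 0 B" for t
      proof -
        have "z j + t * u j \<noteq> 0" if j: "j \<in> insert k S" for j
        proof
          assume eq: "z j + t * u j = 0"
          show False
          proof (cases "u j = 0")
            case True
            then show False using eq j z(2) u(2) by auto
          next
            case False
            then have "t = - z j / u j" using eq by (simp add: field_simps eq_neg_iff_add_eq_0)
            then show False using t j by (auto simp: B_def)
          qed
        qed
        moreover have "(\<lambda>i. z i + t * u i) \<in> W" by (rule line_closedD[OF W z(1) u(1)])
        ultimately show ?thesis using insert.prems(2)[of "\<lambda>i. z i + t * u i"] q by simp
      qed
      moreover have "finite (insert 0 B)" using insert.hyps by (simp add: B_def)
      ultimately have "q = 0" using poly_eq_0_of_cofinite_zeros[OF inf] by blast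
      then show ?thesis using q[of 0] by simp
    qed
    moreover have "\<exists>u\<in>W. u j \<noteq> 0" if "j \<in> S" for j using insert.prems(1) that by blast
    ultimately show ?case using insert.IH by blast
  qed
  then show ?thesis using z by blast
qed


section \<open>Linear independence of monomial functions\<close>

text \<open>Induction on the number of variables, comparing the coefficients of the powers of one of them.\<close>

lemma monomial_functions_independent:
  fixes c :: "'i \<Rightarrow> 'a::field" and \<alpha> :: "'i \<Rightarrow> 'b \<Rightarrow> nat"
  assumes inf: "infinite (UNIV :: 'a set)" and "finite E" "finite A"
    and "\<And>i j. i \<in> A \<Longrightarrow> j \<in> A \<Longrightarrow> (\<forall>k\<in>E. \<alpha> i k = \<alpha> j k) \<Longrightarrow> i = j"
    and "\<And>t :: 'b \<Rightarrow> 'a. (\<Sum>i\<in>A. c i * (\<Prod>k\<in>E. t k ^ \<alpha> i k)) = 0"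
    and "i \<in> A"
  shows "c i = 0"
  using assms(2-)
proof (induction E arbitrary: A i rule: finite_induct)
  case empty
  then have "A = {i}" by blast
  then show ?case using empty.prems(3) by simp
next
  case (insert e E)
  let ?A = "\<lambda>p. {i\<in>A. \<alpha> i e = p}"
  have vanish: "(\<Sum>i\<in>?A p. c i * (\<Prod>k\<in>E. t k ^ \<alpha> i k)) = 0" for p and t :: "'b \<Rightarrow> 'a"
  proof -
    define C where "C i = c i * (\<Prod>k\<in>E. t k ^ \<alpha> i k)" for i
    define q where "q = (\<Sum>i\<in>A. monom (C i) (\<alpha> i e))"
    have "poly q s = 0" for s
    proof -
      have "(\<Prod>k\<in>insert e E. (t(e := s)) k ^ \<alpha> i k) = s ^ \<alpha> i e * (\<Prod>k\<in>E. t k ^ \<alpha> i k)" for i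
      proof -
        have "(\<Prod>k\<in>E. (t(e := s)) k ^ \<alpha> i k) = (\<Prod>k\<in>E. t k ^ \<alpha> i k)"
          by (rule prod.cong[OF refl]) (use insert.hyps in auto)
        then show ?thesis using insert.hyps by simp
      qed
      then have "poly q s = (\<Sum>i\<in>A. c i * (\<Prod>k\<in>insert e E. (t(e := s)) k ^ \<alpha> i k))"
        unfolding q_def C_def poly_sum poly_monom by (simp only: mult_ac)
      then show ?thesis using insert.prems(3) by simp
    qed
    then have "q = 0" using poly_eq_0_of_cofinite_zeros[OF inf, of "{}"] by simp
    then have "0 = coeff q p" by simp
    also have "\<dots> = (\<Sum>i\<in>A. if \<alpha> i e = p then C i else 0)"
      unfolding q_def coeff_sum by simp
    also have "\<dots> = (\<Sum>i\<in>?A p. C i)"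
      using insert.prems(1) by (simp add: sum.If_cases Int_def)
    finally show ?thesis by (simp add: C_def)
  qed
  show ?case
  proof (rule insert.IH[of "?A (\<alpha> i e)"])
    fix i' j assume "i' \<in> ?A (\<alpha> i e)" "j \<in> ?A (\<alpha> i e)" "\<forall>k\<in>E. \<alpha> i' k = \<alpha> j k"
    then show "i' = j" by (intro insert.prems(2)) auto
  qed (use insert.prems vanish in auto)
qed

lemma sum_in_line_closed:
  fixes W :: "(nat \<Rightarrow> 'a::field) set"
  assumes W: "line_closed W" and "finite E" and "\<And>k. k \<in> E \<Longrightarrow> w k \<in> W" and "W \<noteq> {}"
  shows "(\<lambda>i. \<Sum>k\<in>E. t k * w k i) \<in> W"
  using assms(2,3)
proof (induction E rule: finite_induct)
  case empty
  obtain z where "z \<in> W" using assms(4) by blast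
  then have "(\<lambda>i. z i + (- 1) * z i) \<in> W" by (intro line_closedD[OF W])
  then show ?case by simp
next
  case (insert e E)
  have sum: "(\<lambda>i. \<Sum>k\<in>E. t k * w k i) \<in> W" by (rule insert.IH) (use insert.prems in simp)
  have we: "w e \<in> W" using insert.prems by simp
  have "(\<lambda>i. (\<Sum>k\<in>E. t k * w k i) + t e * w e i) \<in> W"
    by (rule line_closedD[OF W sum we])
  then show ?case using insert.hyps by (simp add: add.commute)
qed

text \<open>The factor \<open>z 0 ^ \<beta> * z k ^ (N - \<beta>)\<close> is \<open>(z 0 / z k) ^ \<beta>\<close> after multiplication by the common
  denominator \<open>z k ^ N\<close>.  Let \<open>F i\<close> be the set of all \<open>k \<in> {1..m}\<close> with \<open>\<beta> i k > 0\<close>.  The first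
  family of points says that \<open>F i\<close> contains no broken circuit, the second that the coordinates in \<open>E i\<close> are independent even
  where those in \<open>F i\<close> vanish; \<open>E i\<close> may depend on the term only through \<open>F i\<close>.

  The induction removes the last coordinate.  After division by the highest power of it that all
  terms share, only the terms with the highest pole survive on its zero set, and there the induction
  hypothesis shows that their coefficients vanish.  The points pass to that zero set because the last
  coordinate is a pole of all surviving terms.\<close>

lemma partial_fractions_independent:
  fixes c :: "'i \<Rightarrow> 'a::field" and \<alpha> \<beta> :: "'i \<Rightarrow> nat \<Rightarrow> nat" and E :: "'i \<Rightarrow> nat set"
  assumes inf: "infinite (UNIV :: 'a set)" and "finite A" and "line_closed W"
    and fin: "\<And>i. finite (E i)"
    and "\<And>i k. i \<in> A \<Longrightarrow> \<beta> i k \<le> N"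
    and "\<And>i k. i \<in> A \<Longrightarrow> k \<le> m \<Longrightarrow>
           \<exists>z\<in>W. z k \<noteq> 0 \<and> (\<forall>j\<in>{1..m}. \<beta> i j > 0 \<longrightarrow> k < j \<longrightarrow> z j = 0)"
    and "\<And>i k. i \<in> A \<Longrightarrow> k \<in> E i \<Longrightarrow>
           \<exists>z\<in>W. z k \<noteq> 0 \<and> (\<forall>j\<in>E i - {k}. z j = 0) \<and> (\<forall>j\<in>{1..m}. \<beta> i j > 0 \<longrightarrow> z j = 0)"
    and "\<And>i j. i \<in> A \<Longrightarrow> j \<in> A \<Longrightarrow> (\<forall>k\<in>{1..m}. \<beta> i k > 0 \<longleftrightarrow> \<beta> j k > 0) \<Longrightarrow> E i = E j"
    and "\<And>i j. i \<in> A \<Longrightarrow> j \<in> A \<Longrightarrow> (\<forall>k\<in>{1..m}. \<beta> i k = \<beta> j k) \<Longrightarrow> (\<forall>k\<in>E i. \<alpha> i k = \<alpha> j k) \<Longrightarrow> i = j"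
    and "\<And>z. z \<in> W \<Longrightarrow> (\<Sum>i\<in>A. c i * (\<Prod>k\<in>E i. z k ^ \<alpha> i k) *
             (\<Prod>k\<in>{1..m}. z 0 ^ \<beta> i k * z k ^ (N - \<beta> i k))) = 0"
    and "i \<in> A"
  shows "c i = 0"
  using assms(2,3,5-)
proof (induction m arbitrary: A W i)
  case 0
  note finA = 0(1) and W = 0(2) and nbc = 0(4) and indep = 0(5) and common = 0(6) and dist = 0(7)
    and vanish = 0(8) and iA = 0(9)
  have same: "E j = E i" if "j \<in> A" for j by (rule common[OF that iA]) simp
  obtain z0 where z0: "z0 \<in> W" using nbc[OF iA, of 0] by blast
  have "\<exists>z. z \<in> W \<and> z k = 1 \<and> (\<forall>j\<in>E i - {k}. z j = 0)" if k: "k \<in> E i" for k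
  proof -
    obtain z where z: "z \<in> W" "z k \<noteq> 0" "\<forall>j\<in>E i - {k}. z j = 0" using indep[OF iA k] by blast
    have "(\<lambda>j. \<Sum>k\<in>{k}. inverse (z k) * z j) \<in> W"
      by (rule sum_in_line_closed[OF W]) (use z in auto)
    then show ?thesis using z by (intro exI[of _ "\<lambda>j. inverse (z k) * z j"]) simp
  qed
  then obtain w where w: "\<And>k. k \<in> E i \<Longrightarrow> w k \<in> W \<and> w k k = 1 \<and> (\<forall>j\<in>E i - {k}. w k j = 0)" by metis
  show ?case
  proof (rule monomial_functions_independent[OF inf fin[of i] finA _ _ iA])
    fix t :: "nat \<Rightarrow> 'a"
    define z where "z = (\<lambda>j. \<Sum>k\<in>E i. t k * w k j)"
    have "z \<in> W" unfolding z_def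
      by (rule sum_in_line_closed[OF W fin]) (use w z0 in auto)
    moreover have zk: "z k = t k" if "k \<in> E i" for k
    proof -
      have "z k = (\<Sum>l\<in>E i. if l = k then t k else 0)"
        unfolding z_def by (rule sum.cong[OF refl]) (use w that in force)
      then show ?thesis using that fin by simp
    qed
    ultimately have "(\<Sum>j\<in>A. c j * (\<Prod>k\<in>E j. z k ^ \<alpha> j k)) = 0" using vanish[of z] by simp
    moreover have "(\<Prod>k\<in>E j. z k ^ \<alpha> j k) = (\<Prod>k\<in>E i. t k ^ \<alpha> j k)" if "j \<in> A" for j
      using same[OF that] zk by simp
    ultimately show "(\<Sum>j\<in>A. c j * (\<Prod>k\<in>E i. t k ^ \<alpha> j k)) = 0" by (simp cong: sum.cong)
  next
    fix i' j assume "i' \<in> A" "j \<in> A" "\<forall>k\<in>E i. \<alpha> i' k = \<alpha> j k"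
    then show "i' = j" by (intro dist) (simp_all add: same)
  qed
next
  case (Suc m)
  note finA = Suc.prems(1) and W = Suc.prems(2) and \<beta>N = Suc.prems(3) and nbc = Suc.prems(4)
    and indep = Suc.prems(5) and common = Suc.prems(6) and dist = Suc.prems(7) and vanish = Suc.prems(8)
  show ?case
  proof (rule ccontr)
    assume ci: "c i \<noteq> 0"
    \<comment> \<open>only terms that occur count for the highest pole \<open>e\<close>\<close>
    define A0 where "A0 = {j\<in>A. c j \<noteq> 0}"
    define e where "e = Max ((\<lambda>j. \<beta> j (Suc m)) ` A0)"
    define A' where "A' = {j\<in>A0. \<beta> j (Suc m) = e}"
    have A0: "finite A0" "A0 \<noteq> {}" "A0 \<subseteq> A" using finA ci Suc.prems(9) by (auto simp: A0_def)
    have le_e: "\<beta> j (Suc m) \<le> e" if "j \<in> A0" for j using that A0(1) by (simp add: e_def)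
    have "e \<in> (\<lambda>j. \<beta> j (Suc m)) ` A0" unfolding e_def using A0 by (intro Max_in) auto
    then obtain a where a: "a \<in> A'" by (auto simp: A'_def)
    then have aA: "a \<in> A" and ca: "c a \<noteq> 0" and ae: "\<beta> a (Suc m) = e" by (auto simp: A'_def A0_def)
    have A'A: "A' \<subseteq> A" "finite A'" using A0 by (auto simp: A'_def)
    \<comment> \<open>for \<open>e = 0\<close> no term has a pole along the last coordinate, and there is nothing to restrict to\<close>
    define W' where "W' = (if e = 0 then W else {z\<in>W. z (Suc m) = 0})"
    have W'W: "W' \<subseteq> W" by (auto simp: W'_def)
    have W': "line_closed W'" using W unfolding W'_def line_closed_def by auto
    have inW': "z \<in> W'" if "z \<in> W" "0 < e \<Longrightarrow> z (Suc m) = 0" for z using that by (auto simp: W'_def)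
    \<comment> \<open>the terms without their factor for the last coordinate\<close>
    define f where "f j z = c j * (\<Prod>k\<in>E j. z k ^ \<alpha> j k) *
        (\<Prod>k\<in>{1..m}. z 0 ^ \<beta> j k * z k ^ (N - \<beta> j k))" for j and z :: "nat \<Rightarrow> 'a"
    have f_poly: "line_polynomial (f j)" for j unfolding f_def by (intro line_polynomial_intros)
    have eN: "e \<le> N" using \<beta>N[OF aA, of "Suc m"] ae by simp
    have nbc': "\<exists>z\<in>W'. z k \<noteq> 0 \<and> (\<forall>l\<in>{1..m}. \<beta> j l > 0 \<longrightarrow> k < l \<longrightarrow> z l = 0)"
      if j: "j \<in> A'" and k: "k \<le> m" for j k
    proof -
      obtain z where z: "z \<in> W" "z k \<noteq> 0" "\<forall>l\<in>{1..Suc m}. \<beta> j l > 0 \<longrightarrow> k < l \<longrightarrow> z l = 0"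
        using nbc[of j k] j k A'A by auto
      have "z \<in> W'" using z k j by (intro inW') (auto simp: A'_def)
      then show ?thesis using z by auto
    qed
    have indep': "\<exists>z\<in>W'. z k \<noteq> 0 \<and> (\<forall>l\<in>E j - {k}. z l = 0) \<and> (\<forall>l\<in>{1..m}. \<beta> j l > 0 \<longrightarrow> z l = 0)"
      if j: "j \<in> A'" and k: "k \<in> E j" for j k
    proof -
      obtain z where z: "z \<in> W" "z k \<noteq> 0" "\<forall>l\<in>E j - {k}. z l = 0" "\<forall>l\<in>{1..Suc m}. \<beta> j l > 0 \<longrightarrow> z l = 0"
        using indep[of j k] j k A'A by blast
      have "z \<in> W'" using z j by (intro inW') (auto simp: A'_def)
      then show ?thesis using z by auto
    qed
    have coord: "\<exists>u\<in>W. u k \<noteq> 0" if "k \<le> Suc m" for k using nbc[OF aA that] by blast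
    \<comment> \<open>division by the common power of the last coordinate\<close>
    have divided: "(\<Sum>j\<in>A0. f j z * z 0 ^ \<beta> j (Suc m) * z (Suc m) ^ (e - \<beta> j (Suc m))) = 0" if "z \<in> W" for z
    proof (rule vanishes_of_vanishes_off_hyperplanes[OF inf W _ _ _ _ that, of _ "{Suc m}"])
      show "line_polynomial (\<lambda>z. \<Sum>j\<in>A0. f j z * z 0 ^ \<beta> j (Suc m) * z (Suc m) ^ (e - \<beta> j (Suc m)))"
        by (intro line_polynomial_intros f_poly)
      show "\<exists>u\<in>W. u k \<noteq> 0" if "k \<in> {Suc m}" for k using coord that by simp
      fix z assume z: "z \<in> W" "\<forall>k\<in>{Suc m}. z k \<noteq> 0"
      have "(\<Sum>j\<in>A. f j z * (z 0 ^ \<beta> j (Suc m) * z (Suc m) ^ (N - \<beta> j (Suc m)))) = 0"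
        using vanish[OF z(1)] by (simp add: f_def atLeastAtMostSuc_conv mult_ac)
      moreover have "(\<Sum>j\<in>A. f j z * (z 0 ^ \<beta> j (Suc m) * z (Suc m) ^ (N - \<beta> j (Suc m))))
        = (\<Sum>j\<in>A0. f j z * (z 0 ^ \<beta> j (Suc m) * z (Suc m) ^ (N - \<beta> j (Suc m))))"
        by (rule sum.mono_neutral_right) (auto simp: A0_def f_def finA)
      moreover have "N - \<beta> j (Suc m) = (e - \<beta> j (Suc m)) + (N - e)" if "j \<in> A0" for j
        using le_e[OF that] eN by simp
      ultimately have "(\<Sum>j\<in>A0. f j z * z 0 ^ \<beta> j (Suc m) * z (Suc m) ^ (e - \<beta> j (Suc m))) * z (Suc m) ^ (N - e) = 0"
        by (simp add: sum_distrib_right power_add mult.assoc)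
      then show "(\<Sum>j\<in>A0. f j z * z 0 ^ \<beta> j (Suc m) * z (Suc m) ^ (e - \<beta> j (Suc m))) = 0" using z(2) by simp
    qed simp_all
    have restricted: "(\<Sum>j\<in>A'. f j z) = 0" if "z \<in> W'" for z
    proof (rule vanishes_of_vanishes_off_hyperplanes[OF inf W' _ _ _ _ that, of _ "{0}"])
      show "line_polynomial (\<lambda>z. \<Sum>j\<in>A'. f j z)" by (intro line_polynomial_intros f_poly)
      show "\<exists>u\<in>W'. u k \<noteq> 0" if "k \<in> {0}" for k using nbc'[OF a, of k] that by auto
      fix z assume z: "z \<in> W'" "\<forall>k\<in>{0}. z k \<noteq> 0"
      have "0 = (\<Sum>j\<in>A0. f j z * z 0 ^ \<beta> j (Suc m) * z (Suc m) ^ (e - \<beta> j (Suc m)))"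
        using divided z W'W by (metis (no_types, lifting) subsetD)
      also have "\<dots> = (\<Sum>j\<in>A0. if \<beta> j (Suc m) = e then f j z * z 0 ^ e else 0)"
      proof (rule sum.cong[OF refl])
        fix j assume j: "j \<in> A0"
        show "f j z * z 0 ^ \<beta> j (Suc m) * z (Suc m) ^ (e - \<beta> j (Suc m)) = (if \<beta> j (Suc m) = e then f j z * z 0 ^ e else 0)"
          using le_e[OF j] z(1) by (cases "\<beta> j (Suc m) = e") (auto simp: W'_def split: if_splits)
      qed
      also have "\<dots> = (\<Sum>j\<in>A'. f j z * z 0 ^ e)" using A0(1) by (simp add: sum.If_cases A'_def Int_def)
      finally have "(\<Sum>j\<in>A'. f j z) * z 0 ^ e = 0" by (simp add: sum_distrib_right)
      then show "(\<Sum>j\<in>A'. f j z) = 0" using z(2) by simp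
    qed simp_all
    have upto: "(\<forall>k\<in>{1..Suc m}. Q k) \<longleftrightarrow> (\<forall>k\<in>{1..m}. Q k) \<and> Q (Suc m)" for Q
      by (simp add: atLeastAtMostSuc_conv) blast
    have "c a = 0"
    proof (rule Suc.IH[OF A'A(2) W' _ nbc' indep' _ _ _ a])
      show "\<beta> j k \<le> N" if "j \<in> A'" for j k using \<beta>N that A'A by blast
      show "E i = E j" if ij: "i \<in> A'" "j \<in> A'" "\<forall>k\<in>{1..m}. \<beta> i k > 0 \<longleftrightarrow> \<beta> j k > 0" for i j
      proof (rule common[OF _ _ iffD2[OF upto conjI[OF ij(3)]]])
        show "\<beta> i (Suc m) > 0 \<longleftrightarrow> \<beta> j (Suc m) > 0" using ij(1,2) by (simp add: A'_def)
      qed (use ij(1,2) A'A in blast)+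
      show "i = j" if ij: "i \<in> A'" "j \<in> A'" "\<forall>k\<in>{1..m}. \<beta> i k = \<beta> j k" "\<forall>k\<in>E i. \<alpha> i k = \<alpha> j k" for i j
      proof (rule dist[OF _ _ iffD2[OF upto conjI[OF ij(3)]] ij(4)])
        show "\<beta> i (Suc m) = \<beta> j (Suc m)" using ij(1,2) by (simp add: A'_def)
      qed (use ij(1,2) A'A in blast)+
    qed (assumption | rule restricted[unfolded f_def])+
    then show False using ca by simp
  qed
qed


section \<open>Polynomials that vanish on the graph\<close>

definition bigraded :: "nat \<Rightarrow> nat \<Rightarrow> nat \<Rightarrow> 'k::field bipoly \<Rightarrow> bool" where
  "bigraded n d e f \<longleftrightarrow> Poly_Mapping.keys f \<subseteq> monomials n \<and>
     (\<forall>m\<in>Poly_Mapping.keys f. (\<Sum>i\<le>n. Poly_Mapping.lookup m (XVar i)) = d \<and>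
        (\<Sum>i\<le>n. Poly_Mapping.lookup m (YVar i)) = e)"

lemma bihomogeneous_if_bigraded: "bigraded n d e f \<Longrightarrow> bihomogeneous n f"
  unfolding bigraded_def bihomogeneous_def by auto

lemma bigraded_zero: "bigraded n d e 0"
  by (simp add: bigraded_def)

lemma bigraded_add: "bigraded n d e f \<Longrightarrow> bigraded n d e g \<Longrightarrow> bigraded n d e (f + g)"
  using Poly_Mapping.keys_add[of f g] unfolding bigraded_def by blast

lemma bigraded_diff: "bigraded n d e f \<Longrightarrow> bigraded n d e g \<Longrightarrow> bigraded n d e (f - g)"
  using keys_diff_subset[of f g] unfolding bigraded_def by blast

lemma bigraded_sum: "(\<And>i. i \<in> A \<Longrightarrow> bigraded n d e (f i)) \<Longrightarrow> bigraded n d e (\<Sum>i\<in>A. f i)"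
  by (induction A rule: infinite_finite_induct) (simp_all add: bigraded_zero bigraded_add)

lemma bigraded_mult:
  assumes "bigraded n d e f" "bigraded n d' e' g"
  shows "bigraded n (d + d') (e + e') (f * g)"
  unfolding bigraded_def
proof (intro conjI ballI)
  show "Poly_Mapping.keys (f * g) \<subseteq> monomials n"
    using assms keys_mult_monomials unfolding bigraded_def by blast
  fix m assume "m \<in> Poly_Mapping.keys (f * g)"
  then obtain s t where m: "m = s + t" "s \<in> Poly_Mapping.keys f" "t \<in> Poly_Mapping.keys g"
    using Poly_Mapping.keys_mult[of f g] by blast
  then show "(\<Sum>i\<le>n. Poly_Mapping.lookup m (XVar i)) = d + d'" "(\<Sum>i\<le>n. Poly_Mapping.lookup m (YVar i)) = e + e'"
    using assms unfolding bigraded_def by (simp_all add: lookup_add sum.distrib)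
qed

lemma bigraded_pconst: "bigraded n 0 0 (pconst c)"
  by (auto simp: bigraded_def pconst_def monomials_0)

lemma bigraded_px: "i \<le> n \<Longrightarrow> bigraded n 1 0 (px i)"
  by (auto simp: bigraded_def pvar_def monomials_iff lookup_mvar bivars_def mvar_def lookup_single when_def)

lemma bigraded_py: "i \<le> n \<Longrightarrow> bigraded n 0 1 (py i)"
  by (auto simp: bigraded_def pvar_def monomials_iff lookup_mvar bivars_def mvar_def lookup_single when_def)

lemma bigraded_one: "bigraded n 0 0 1"
  by (auto simp: bigraded_def monomials_0)

lemma bigraded_prod_py:
  assumes "finite A" "\<And>i. i \<in> A \<Longrightarrow> i \<le> n"
  shows "bigraded n 0 (card A) (\<Prod>i\<in>A. py i)"
  using assms
proof (induction A rule: finite_induct)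
  case empty
  then show ?case by (simp add: bigraded_one)
next
  case (insert i A)
  then show ?case using bigraded_mult[OF bigraded_py, of i n 0 "card A" "\<Prod>i\<in>A. py i"] by simp
qed

text \<open>The vectors of the Cremona graph have nonzero coordinates, so they represent points of the
  product of projective spaces and lie in the Zariski closure; and by definition the closure imposes
  no further bihomogeneous equations.\<close>

lemma reciprocal_ideal_eq:
  fixes x :: "nat \<Rightarrow> 'v \<Rightarrow> 'k::field"
  shows "reciprocal_ideal n x = Idl\<^bsub>coord_ring n\<^esub> {f. bihomogeneous n f \<and> f \<in> vanishing_ideal n (cremona_graph n x)}"
proof -
  have "(z, w) \<in> biproj_points n" if "(z, w) \<in> cremona_graph n x" for z w
  proof -
    have "z 0 \<noteq> 0" "w 0 \<noteq> 0" using that by (auto simp: cremona_graph_def)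
    then show ?thesis unfolding biproj_points_def by blast
  qed
  then have sub: "cremona_graph n x \<subseteq> reciprocal_graph n x"
    unfolding reciprocal_graph_def bizariski_closure_def by auto
  have "bihomogeneous n f \<and> (\<forall>p\<in>reciprocal_graph n x. bieval f p = 0) \<longleftrightarrow>
      bihomogeneous n f \<and> f \<in> vanishing_ideal n (cremona_graph n x)" for f
    using sub unfolding reciprocal_graph_def bizariski_closure_def vanishing_ideal_def bihomogeneous_def by auto
  then show ?thesis unfolding reciprocal_ideal_def by simp
qed

lemma line_closed_geom_space: "line_closed (geom_space n x)"
  unfolding line_closed_def
proof (intro ballI allI)
  fix z u t assume "z \<in> geom_space n x" "u \<in> geom_space n x"
  then obtain V c V' c' where V: "finite V" "\<And>i. i \<le> n \<Longrightarrow> z i = (\<Sum>v\<in>V. c v * to_ac (x i v))"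
    and V': "finite V'" "\<And>i. i \<le> n \<Longrightarrow> u i = (\<Sum>v\<in>V'. c' v * to_ac (x i v))"
    unfolding geom_space_def by blast
  \<comment> \<open>both families of coefficients extended by \<open>0\<close> to the union\<close>
  define b where "b v = (if v \<in> V then c v else 0) + t * (if v \<in> V' then c' v else 0)" for v
  have "z i + t * u i = (\<Sum>v\<in>V \<union> V'. b v * to_ac (x i v))" if "i \<le> n" for i
  proof -
    have "(\<Sum>v\<in>V. c v * to_ac (x i v)) = (\<Sum>v\<in>V \<union> V'. (if v \<in> V then c v else 0) * to_ac (x i v))"
      by (rule sum.mono_neutral_cong_left) (use V V' in auto)
    moreover have "(\<Sum>v\<in>V'. c' v * to_ac (x i v)) = (\<Sum>v\<in>V \<union> V'. (if v \<in> V' then c' v else 0) * to_ac (x i v))"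
      by (rule sum.mono_neutral_cong_left) (use V V' in auto)
    ultimately show ?thesis
      using that V(2) V'(2) by (simp add: b_def distrib_right sum.distrib sum_distrib_left mult.assoc)
  qed
  moreover have "finite (V \<union> V')" using V V' by simp
  ultimately show "(\<lambda>i. z i + t * u i) \<in> geom_space n x" unfolding geom_space_def by blast
qed

lemma rational_point_in_geom_space: "(\<lambda>i. to_ac (x i v)) \<in> geom_space n x"
  unfolding geom_space_def by (intro CollectI exI[of _ "{v}"] exI[of _ "\<lambda>v. 1"]) simp

lemma geom_space_relation:
  assumes rel: "\<And>v. (\<Sum>i\<in>D. b i * x i v) = 0" and D: "D \<subseteq> {..n}" and z: "z \<in> geom_space n x"
  shows "(\<Sum>i\<in>D. to_ac (b i) * z i) = 0"
proof -
  obtain V c where V: "\<And>i. i \<le> n \<Longrightarrow> z i = (\<Sum>v\<in>V. c v * to_ac (x i v))"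
    using z unfolding geom_space_def by blast
  have "(\<Sum>i\<in>D. to_ac (b i) * z i) = (\<Sum>i\<in>D. \<Sum>v\<in>V. c v * to_ac (b i * x i v))"
    by (rule sum.cong[OF refl]) (use D V in \<open>auto simp: sum_distrib_left mult_ac\<close>)
  also have "\<dots> = (\<Sum>v\<in>V. c v * to_ac (\<Sum>i\<in>D. b i * x i v))"
    by (subst sum.swap) (simp add: to_ac_sum sum_distrib_left)
  finally show ?thesis using rel by simp
qed

text \<open>Otherwise \<open>1\<close> plus the product of all monic linear polynomials would have no root.\<close>

lemma infinite_alg_closed: "infinite (UNIV :: 'a::alg_closed_field set)"
proof
  assume fin: "finite (UNIV :: 'a set)"
  define q where "q = (\<Prod>a\<in>(UNIV::'a set). [:- a, 1:])"
  have "degree q = card (UNIV :: 'a set)"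
    unfolding q_def by (subst degree_prod_eq_sum_degree) auto
  then have dq: "degree q > 0" using fin by (simp add: card_gt_0_iff)
  then have "degree (q + 1) > 0" by (simp add: degree_add_eq_left)
  then obtain b where "poly (q + 1) b = 0" using alg_closed_imp_poly_has_root by blast
  moreover have "poly q b = 0" unfolding q_def poly_prod using fin by (intro prod_zero) auto
  ultimately show False by simp
qed


section \<open>Standard monomials on the graph\<close>

context ordered_forms
begin

text \<open>The reduction to partial fractions: on the graph, with the second factor scaled by \<open>t\<close>, a monomial
  of \<open>y\<close>-degree \<open>e\<close> is \<open>t ^ e\<close> times a Laurent monomial in the coordinates of the first factor.  As a
  polynomial in \<open>t\<close> this separates the \<open>y\<close>-degrees.  Within one of them, multiplication by \<open>z 0 ^ e\<close>
  turns the power of \<open>y 0\<close>, which is determined by the other exponents, into the numerators of the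
  fractions \<open>z 0 / z k\<close>.\<close>

lemma standard_polynomial_eq_0:
  assumes f: "f \<in> vanishing_ideal n (cremona_graph n x)"
    and std: "\<And>m B. m \<in> Poly_Mapping.keys f \<Longrightarrow> B \<in> enbc_nonfaces \<Longrightarrow> \<not> B \<subseteq> Poly_Mapping.keys m"
  shows "f = 0"
proof (rule ccontr)
  assume "f \<noteq> 0"
  then obtain m0 where m0: "m0 \<in> Poly_Mapping.keys f" by (metis all_not_in_conv keys_eq_empty)
  define W where "W = geom_space n x"
  define \<alpha> where "\<alpha> m k = Poly_Mapping.lookup m (XVar k)" for m :: monomial and k
  define \<beta> where "\<beta> m k = Poly_Mapping.lookup m (YVar k)" for m :: monomial and k
  define F where "F m = {k\<in>{1..n}. \<beta> m k > 0}" for m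
  define E where "E m = lex_basis n x P (F m) - F m" for m
  define ydeg where "ydeg m = (\<Sum>k\<le>n. \<beta> m k)" for m
  define e where "e = ydeg m0"
  \<comment> \<open>one \<open>y\<close>-degree at a time; it also bounds the orders of the poles\<close>
  define A where "A = {m\<in>Poly_Mapping.keys f. ydeg m = e}"
  have inf: "infinite (UNIV :: 'k alg_closure set)" by (rule infinite_alg_closed)
  have W: "line_closed W" unfolding W_def by (rule line_closed_geom_space)
  have keys_f: "Poly_Mapping.keys f \<subseteq> monomials n" using f by (simp add: vanishing_ideal_def)
  have finA: "finite A" by (simp add: A_def)
  have Fn: "F m \<subseteq> {..n}" "F m \<subseteq> {1..n}" for m by (auto simp: F_def)
  have F_support: "YVar k \<in> Poly_Mapping.keys m" if "k \<in> F m" for k m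
    using that by (simp add: F_def \<beta>_def in_keys_iff)
  have nbc: "F m \<in> nbc_complex n x" if m: "m \<in> Poly_Mapping.keys f" for m
  proof -
    have "\<not> B \<subseteq> F m" if B: "broken_circuit n x B" for B
    proof
      assume "B \<subseteq> F m"
      then have "YVar ` B \<subseteq> Poly_Mapping.keys m" using F_support by blast
      moreover have "YVar ` B \<in> enbc_nonfaces" using B unfolding enbc_nonfaces_def by blast
      ultimately show False using std[OF m] by blast
    qed
    then show ?thesis using Fn(1) unfolding nbc_complex_def by blast
  qed
  have E_eq: "E m = {j. j \<le> n \<and> \<not> in_span x j (after j \<union> F m)}" for m
    unfolding E_def by (rule lex_basis_minus[OF Fn(1)])
  have En: "E m \<subseteq> {..n}" for m unfolding E_eq by auto
  have finE: "finite (E m)" for m using finite_subset[OF En] by simp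
  have \<alpha>E: "\<alpha> m k = 0" if m: "m \<in> Poly_Mapping.keys f" and k: "k \<le> n" "k \<notin> E m" for m k
  proof (rule ccontr)
    assume "\<alpha> m k \<noteq> 0"
    then have "insert (XVar k) (YVar ` F m) \<subseteq> Poly_Mapping.keys m"
      using F_support by (auto simp: \<alpha>_def in_keys_iff)
    moreover have "insert (XVar k) (YVar ` F m) \<in> enbc_nonfaces"
      using k Fn(2) by (intro enbc_nonfacesI) (auto simp: E_eq)
    ultimately show False using std[OF m] by blast
  qed
  have nbc_point: "\<exists>z\<in>W. z k \<noteq> 0 \<and> (\<forall>j\<in>{1..n}. \<beta> m j > 0 \<longrightarrow> k < j \<longrightarrow> z j = 0)"
    if m: "m \<in> Poly_Mapping.keys f" and k: "k \<le> n" for m k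
  proof -
    have "\<not> in_span x k {j \<in> F m. k < j}" by (rule nbc_not_in_span_of_larger[OF nbc[OF m] k])
    moreover have "{j \<in> F m. k < j} \<subseteq> {..n}" using Fn(1) by auto
    ultimately obtain v where v: "x k v \<noteq> 0" "\<And>j. j \<in> {j \<in> F m. k < j} \<Longrightarrow> x j v = 0"
      using separating_vector k by blast
    have "(\<lambda>i. to_ac (x i v)) \<in> W" unfolding W_def by (rule rational_point_in_geom_space)
    then show ?thesis using v by (intro bexI[of _ "\<lambda>i. to_ac (x i v)"]) (simp_all add: F_def)
  qed
  have indep_point: "\<exists>z\<in>W. z k \<noteq> 0 \<and> (\<forall>j\<in>E m - {k}. z j = 0) \<and> (\<forall>j\<in>{1..n}. \<beta> m j > 0 \<longrightarrow> z j = 0)"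
    if m: "m \<in> Poly_Mapping.keys f" and k: "k \<in> E m" for m k
  proof -
    have "independent_forms x (E m \<union> F m)" unfolding E_def by (rule lex_basis_independent[OF nbc[OF m]])
    moreover have "finite (E m \<union> F m)" using finE finite_subset[OF Fn(1)] by simp
    ultimately have "\<not> in_span x k (E m \<union> F m - {k})" using k independent_forms_iff by blast
    moreover have "E m \<union> F m - {k} \<subseteq> {..n}" using En Fn(1) by blast
    moreover have "k \<le> n" using k En by auto
    ultimately obtain v where v: "x k v \<noteq> 0" "\<And>j. j \<in> E m \<union> F m - {k} \<Longrightarrow> x j v = 0"
      using separating_vector by blast
    have kF: "k \<notin> F m" using k unfolding E_def by blast
    have "(\<lambda>i. to_ac (x i v)) \<in> W" unfolding W_def by (rule rational_point_in_geom_space)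
    moreover have "x j v = 0" if "j \<in> {1..n}" "\<beta> m j > 0" for j
      using v(2)[of j] kF that by (cases "j = k") (auto simp: F_def)
    ultimately show ?thesis using v by (intro bexI[of _ "\<lambda>i. to_ac (x i v)"]) simp_all
  qed
  define summand where "summand z m = to_ac (Poly_Mapping.lookup f m) * (\<Prod>k\<in>E m. z k ^ \<alpha> m k) *
      (\<Prod>k\<in>{1..n}. z 0 ^ \<beta> m k * z k ^ (e - \<beta> m k))" for z :: "'k geom_vec" and m
  have \<beta>_le: "\<beta> m k \<le> ydeg m" if "k \<le> n" for m k
    unfolding ydeg_def by (rule member_le_sum) (use that in auto)
  have split0: "{..n} = insert 0 {1..n}" by auto
  have off: "(\<Sum>m\<in>A. summand z m) = 0" if z: "z \<in> W" "\<forall>k\<in>{..n}. z k \<noteq> 0" for z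
  proof -
    define C where "C m = to_ac (Poly_Mapping.lookup f m) * (\<Prod>k\<le>n. z k ^ \<alpha> m k) *
        (\<Prod>k\<le>n. inverse (z k) ^ \<beta> m k)" for m
    \<comment> \<open>the value of \<open>f\<close> as a polynomial in the scaling of the second factor\<close>
    define q where "q = (\<Sum>m\<in>Poly_Mapping.keys f. monom (C m) (ydeg m))"
    have "poly q t = 0" if t: "t \<notin> {0}" for t
    proof -
      let ?p = "(z, \<lambda>i. t * inverse (z i))"
      have "?p \<in> cremona_graph n x"
        using z t unfolding cremona_graph_def W_def by (auto intro!: exI[of _ t])
      then have "0 = bieval f ?p" using f by (simp add: vanishing_ideal_def)
      also have "\<dots> = (\<Sum>m\<in>Poly_Mapping.keys f. C m * t ^ ydeg m)"
        unfolding bieval_eq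
      proof (rule sum.cong[OF refl])
        fix m assume "m \<in> Poly_Mapping.keys f"
        then have "m \<in> monomials n" using keys_f by blast
        then have "Poly_Mapping.keys m \<subseteq> bivars n" by (simp only: monomials_iff)
        then have "mono_eval m ?p = (\<Prod>v\<in>bivars n. coordinate ?p v ^ Poly_Mapping.lookup m v)"
          by (rule mono_eval_superset[OF finite_bivars])
        also have "\<dots> = (\<Prod>v\<in>XVar ` {..n}. coordinate ?p v ^ Poly_Mapping.lookup m v) *
            (\<Prod>v\<in>YVar ` {..n}. coordinate ?p v ^ Poly_Mapping.lookup m v)"
          unfolding bivars_def by (rule prod.union_disjoint) auto
        also have "\<dots> = (\<Prod>k\<le>n. z k ^ \<alpha> m k) * (\<Prod>k\<le>n. (t * inverse (z k)) ^ \<beta> m k)"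
          by (simp add: prod.reindex inj_on_def coordinate_def \<alpha>_def \<beta>_def)
        also have "(\<Prod>k\<le>n. (t * inverse (z k)) ^ \<beta> m k) = t ^ ydeg m * (\<Prod>k\<le>n. inverse (z k) ^ \<beta> m k)"
          by (simp add: power_mult_distrib prod.distrib ydeg_def power_sum)
        finally show "to_ac (Poly_Mapping.lookup f m) * mono_eval m ?p = C m * t ^ ydeg m"
          by (simp add: C_def mult_ac)
      qed
      also have "\<dots> = poly q t" by (simp add: q_def poly_sum poly_monom)
      finally show ?thesis by simp
    qed
    then have "q = 0" using poly_eq_0_of_cofinite_zeros[OF inf, of "{0}" q] by simp
    then have "0 = coeff q e" by simp
    also have "\<dots> = (\<Sum>m\<in>Poly_Mapping.keys f. if ydeg m = e then C m else 0)"
      unfolding q_def coeff_sum by simp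
    also have "\<dots> = (\<Sum>m\<in>A. C m)" by (simp add: sum.If_cases A_def Int_def)
    finally have C0: "(\<Sum>m\<in>A. C m) = 0" by simp
    \<comment> \<open>clearing denominators multiplies all terms by the same nonzero factor\<close>
    have "summand z m = C m * (z 0 ^ e * (\<Prod>k\<in>{1..n}. z k ^ e))" if m: "m \<in> A" for m
    proof -
      have mf: "m \<in> Poly_Mapping.keys f" and em: "ydeg m = e" using m by (auto simp: A_def)
      have z0: "z 0 \<noteq> 0" using z(2) by simp
      have 1: "(\<Prod>k\<in>E m. z k ^ \<alpha> m k) = (\<Prod>k\<le>n. z k ^ \<alpha> m k)"
        by (rule prod.mono_neutral_left) (use En \<alpha>E[OF mf] in auto)
      have 2: "(\<Prod>k\<le>n. inverse (z k) ^ \<beta> m k) = inverse (z 0) ^ \<beta> m 0 * (\<Prod>k\<in>{1..n}. inverse (z k) ^ \<beta> m k)"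
        unfolding split0 by simp
      have "e = \<beta> m 0 + (\<Sum>k\<in>{1..n}. \<beta> m k)" unfolding em[symmetric] ydeg_def split0 by simp
      then have "inverse (z 0) ^ \<beta> m 0 * z 0 ^ e = z 0 ^ (\<Sum>k\<in>{1..n}. \<beta> m k)"
        using z0 by (simp add: power_add power_inverse)
      then have 3: "inverse (z 0) ^ \<beta> m 0 * z 0 ^ e = (\<Prod>k\<in>{1..n}. z 0 ^ \<beta> m k)"
        by (simp add: power_sum)
      have 4: "z k ^ (e - \<beta> m k) = inverse (z k) ^ \<beta> m k * z k ^ e" if k: "k \<in> {1..n}" for k
      proof -
        have "z k \<noteq> 0" using z(2) k by simp
        moreover have "\<beta> m k \<le> e" using \<beta>_le[of k m] em k by simp
        ultimately show ?thesis by (simp add: power_diff power_inverse field_simps)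
      qed
      have "(\<Prod>k\<in>{1..n}. z 0 ^ \<beta> m k * z k ^ (e - \<beta> m k)) =
          (\<Prod>k\<in>{1..n}. z 0 ^ \<beta> m k) * ((\<Prod>k\<in>{1..n}. inverse (z k) ^ \<beta> m k) * (\<Prod>k\<in>{1..n}. z k ^ e))"
        unfolding prod.distrib[symmetric] by (rule prod.cong[OF refl]) (simp only: 4)
      then show ?thesis unfolding summand_def C_def 1 2 3[symmetric] by (simp only: mult_ac)
    qed
    then have "(\<Sum>m\<in>A. summand z m) = (\<Sum>m\<in>A. C m) * (z 0 ^ e * (\<Prod>k\<in>{1..n}. z k ^ e))"
      by (simp add: sum_distrib_right)
    then show ?thesis using C0 by simp
  qed
  have vanish: "(\<Sum>m\<in>A. summand z m) = 0" if "z \<in> W" for z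
  proof (rule vanishes_of_vanishes_off_hyperplanes[OF inf W _ _ _ off that])
    show "line_polynomial (\<lambda>z. \<Sum>m\<in>A. summand z m)"
      unfolding summand_def by (intro line_polynomial_intros)
    show "\<exists>u\<in>W. u k \<noteq> 0" if "k \<in> {..n}" for k using nbc_point[OF m0, of k] that by auto
  qed simp_all
  have "to_ac (Poly_Mapping.lookup f m0) = 0"
  proof (rule partial_fractions_independent[where A = A and W = W and E = E and \<alpha> = \<alpha> and \<beta> = \<beta>
        and N = e and m = n and c = "\<lambda>m. to_ac (Poly_Mapping.lookup f m)"])
    show "\<exists>z\<in>W. z k \<noteq> 0 \<and> (\<forall>j\<in>{1..n}. 0 < \<beta> m j \<longrightarrow> k < j \<longrightarrow> z j = 0)" if "m \<in> A" "k \<le> n" for m k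
      using that by (intro nbc_point) (auto simp: A_def)
    show "\<exists>z\<in>W. z k \<noteq> 0 \<and> (\<forall>j\<in>E m - {k}. z j = 0) \<and> (\<forall>j\<in>{1..n}. 0 < \<beta> m j \<longrightarrow> z j = 0)"
      if "m \<in> A" "k \<in> E m" for m k
      using that by (intro indep_point) (auto simp: A_def)
    show "E m = E m'" if "m \<in> A" "m' \<in> A" "\<forall>k\<in>{1..n}. (0 < \<beta> m k) = (0 < \<beta> m' k)" for m m'
    proof -
      have "F m = F m'" using that(3) unfolding F_def by blast
      then show ?thesis by (simp add: E_def)
    qed
    show "m = m'" if m: "m \<in> A" "m' \<in> A" and \<beta>: "\<forall>k\<in>{1..n}. \<beta> m k = \<beta> m' k" and \<alpha>: "\<forall>k\<in>E m. \<alpha> m k = \<alpha> m' k" for m m'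
    proof (rule poly_mapping_eqI)
      have keys: "m \<in> Poly_Mapping.keys f" "m' \<in> Poly_Mapping.keys f" and deg: "ydeg m = ydeg m'"
        using m by (auto simp: A_def)
      have "F m = F m'" using \<beta> unfolding F_def by auto
      then have EE: "E m = E m'" by (simp add: E_def)
      have x_eq: "\<alpha> m k = \<alpha> m' k" if "k \<le> n" for k
        using \<alpha> \<alpha>E[OF keys(1) that] \<alpha>E[OF keys(2) that] EE by (cases "k \<in> E m") auto
      have "\<beta> m 0 + (\<Sum>k\<in>{1..n}. \<beta> m k) = \<beta> m' 0 + (\<Sum>k\<in>{1..n}. \<beta> m' k)"
        using deg unfolding ydeg_def split0 by simp
      moreover have "(\<Sum>k\<in>{1..n}. \<beta> m k) = (\<Sum>k\<in>{1..n}. \<beta> m' k)" by (rule sum.cong[OF refl]) (use \<beta> in blast)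
      ultimately have "\<beta> m 0 = \<beta> m' 0" by simp
      then have y_eq: "\<beta> m k = \<beta> m' k" if "k \<le> n" for k using \<beta> that by (cases "k = 0") auto
      fix v
      show "Poly_Mapping.lookup m v = Poly_Mapping.lookup m' v"
      proof (cases "v \<in> bivars n")
        case True
        then show ?thesis using x_eq y_eq by (auto simp: bivars_def \<alpha>_def \<beta>_def)
      next
        case False
        have "m \<in> monomials n" "m' \<in> monomials n" using keys keys_f by auto
        then have "v \<notin> Poly_Mapping.keys m" "v \<notin> Poly_Mapping.keys m'"
          using False unfolding monomials_iff by auto
        then show ?thesis by (simp add: in_keys_iff)
      qed
    qed
    show "m0 \<in> A" using m0 by (simp add: A_def e_def)
    show "\<beta> m k \<le> e" if "m \<in> A" for m k
    proof (cases "k \<le> n")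
      case True
      then show ?thesis using \<beta>_le[OF True, of m] that by (simp add: A_def)
    next
      case False
      then have "YVar k \<notin> bivars n" by (auto simp: bivars_def)
      moreover have "m \<in> monomials n" using that keys_f by (auto simp: A_def)
      ultimately have "YVar k \<notin> Poly_Mapping.keys m" unfolding monomials_iff by auto
      then show ?thesis by (simp add: \<beta>_def in_keys_iff)
    qed
  qed (use inf W finA finE vanish[unfolded summand_def] in auto)
  then show False using m0 by (simp add: in_keys_iff)
qed

end


section \<open>The Groebner basis of the reciprocal ideal\<close>

lemma pconst_add: "pconst (a + b) = pconst a + pconst b"
  by (simp add: pconst_def single_add)

lemma pconst_mult: "pconst (a * b) = pconst a * pconst b"
  by (simp add: pconst_def mult_single)

lemma pconst_0: "pconst 0 = 0"
  by (simp add: pconst_def)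

lemma pconst_1: "pconst 1 = 1"
  by (simp add: pconst_def)

lemma keys_pconst: "Poly_Mapping.keys (pconst c) \<subseteq> monomials n"
  by (simp add: pconst_def monomials_0)

lemma genideal_pterm_mono:
  fixes M M' :: "monomial set"
  assumes "M \<subseteq> monomials n" "M' \<subseteq> monomials n"
    and "\<And>m. m \<in> M \<Longrightarrow> \<exists>m'\<in>M'. \<exists>u\<in>monomials n. m = m' + u"
  shows "Idl\<^bsub>coord_ring n\<^esub> {pterm m | m. m \<in> M} \<subseteq> (Idl\<^bsub>coord_ring n\<^esub> {pterm m | m. m \<in> M'} :: 'k::field bipoly set)"
proof (rule genideal_poly(3))
  let ?G = "{pterm m | m. m \<in> M'} :: 'k bipoly set"
  have G: "\<And>g. g \<in> ?G \<Longrightarrow> Poly_Mapping.keys g \<subseteq> monomials n" using assms(2) by auto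
  note ideal = genideal_poly(1,2)[of ?G, OF G]
  show "poly_ideal n (Idl\<^bsub>coord_ring n\<^esub> ?G)" by (rule ideal(1))
  show "{pterm m | m. m \<in> M} \<subseteq> Idl\<^bsub>coord_ring n\<^esub> ?G"
  proof
    fix g :: "'k bipoly" assume "g \<in> {pterm m | m. m \<in> M}"
    then obtain m' u where g: "m' \<in> M'" "u \<in> monomials n" "g = pterm (m' + u)" using assms(3) by blast
    have "pterm u * pterm m' \<in> Idl\<^bsub>coord_ring n\<^esub> ?G"
      by (rule poly_ideal_mult[OF ideal(1)]) (use g ideal(2) in auto)
    then show "g \<in> Idl\<^bsub>coord_ring n\<^esub> ?G" by (simp add: g(3) pterm_add mult.commute)
  qed
qed (use assms(1) in auto)

lemma genideal_pterm_eq: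
  fixes M M' :: "monomial set"
  assumes "M \<subseteq> monomials n" "M' \<subseteq> monomials n"
    and "\<And>m. m \<in> M \<Longrightarrow> \<exists>m'\<in>M'. \<exists>u\<in>monomials n. m = m' + u"
    and "\<And>m. m \<in> M' \<Longrightarrow> \<exists>m'\<in>M. \<exists>u\<in>monomials n. m = m' + u"
  shows "Idl\<^bsub>coord_ring n\<^esub> {pterm m | m. m \<in> M} = (Idl\<^bsub>coord_ring n\<^esub> {pterm m | m. m \<in> M'} :: 'k::field bipoly set)"
  by (intro equalityI genideal_pterm_mono assms)

context monomial_order
begin

lemma leading_form:
  fixes b :: "'i \<Rightarrow> 'k::field"
  assumes D: "finite D" "\<And>k. k \<in> D \<Longrightarrow> (h k, g) \<in> T - Id" and g: "g \<in> monomials n"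
    and f: "f = pterm g - (\<Sum>k\<in>D. pconst (b k) * pterm (h k))"
  shows "Poly_Mapping.lookup f g = 1"
    and "Poly_Mapping.keys f \<subseteq> insert g (h ` D)"
    and "init_term T f = g"
proof -
  have lookup_f: "Poly_Mapping.lookup f m = (1 when g = m) - (\<Sum>k\<in>D. b k when h k = m)" for m
    unfolding f lookup_minus lookup_sum pconst_mult_pterm by (simp add: pterm_def lookup_single)
  have "(\<Sum>k\<in>D. b k when h k = g) = 0"
    by (rule sum.neutral) (use D(2) in \<open>auto simp: when_def\<close>)
  then show 1: "Poly_Mapping.lookup f g = 1" by (simp add: lookup_f)
  show 2: "Poly_Mapping.keys f \<subseteq> insert g (h ` D)"
  proof
    fix m assume m: "m \<in> Poly_Mapping.keys f"
    show "m \<in> insert g (h ` D)"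
    proof (rule ccontr)
      assume "m \<notin> insert g (h ` D)"
      then have "Poly_Mapping.lookup f m = 0"
        unfolding lookup_f by (auto simp: when_def intro!: sum.neutral)
      then show False using m by (simp add: in_keys_iff)
    qed
  qed
  show "init_term T f = g"
  proof (rule init_term_eqI)
    show "g \<in> Poly_Mapping.keys f" using 1 by (simp add: in_keys_iff)
    fix m' assume "m' \<in> Poly_Mapping.keys f"
    then show "(m', g) \<in> T" using 2 D(2) T_order(2)[OF g] by auto
  qed
qed

lemma T_strict_add:
  assumes "(s, t) \<in> T - Id" "u \<in> monomials n"
  shows "(s + u, t + u) \<in> T - Id"
  using assms T_order(6) by auto

end

locale reciprocal_arrangement = ordered_forms scale x n P + monomial_order n T
  for scale :: "'k::field \<Rightarrow> 'v::ab_group_add \<Rightarrow> 'v" and x :: "nat \<Rightarrow> 'v \<Rightarrow> 'k" and n P T +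
  fixes a :: "nat set \<Rightarrow> nat \<Rightarrow> 'k"
  assumes circuit_coefficients: "\<And>C. matroid_circuit n x C \<Longrightarrow> circuit_relation x C (a C)"
    and x_order: "\<And>i j. (i, j) \<in> P \<Longrightarrow> i \<noteq> j \<Longrightarrow> (mvar (XVar j), mvar (XVar i)) \<in> T - Id"
    and y_order: "\<And>i j. i \<le> n \<Longrightarrow> j \<le> n \<Longrightarrow> i > j \<Longrightarrow> (mvar (YVar j), mvar (YVar i)) \<in> T - Id"
    and y0_order: "\<And>b s t. \<lbrakk>b \<ge> 1; s \<in> monomials n; t \<in> monomials n; mdegree s = mdegree t;
           b \<le> Poly_Mapping.lookup s (YVar 0); \<not> b \<le> Poly_Mapping.lookup t (YVar 0)\<rbrakk> \<Longrightarrow> (s, t) \<in> T - Id"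
begin

definition generators :: "'k bipoly set" where
  "generators = {\<Sum>i\<in>C. pconst (a C i) * px i | C. matroid_circuit n x C}
     \<union> {\<Sum>i\<in>C. pconst (a C i) * (\<Prod>j\<in>C - {i}. py j) | C. matroid_circuit n x C}
     \<union> {px i * py i - px 0 * py 0 | i. 1 \<le> i \<and> i \<le> n}"

definition J :: "'k bipoly set" where
  "J = Idl\<^bsub>coord_ring n\<^esub> generators"

abbreviation V :: "'k bipoly set" where
  "V \<equiv> vanishing_ideal n (cremona_graph n x)"

lemma generator_cases [consumes 1, case_names linear cremona product]:
  assumes "g \<in> generators"
  obtains C where "matroid_circuit n x C" "g = (\<Sum>i\<in>C. pconst (a C i) * px i)"
  | C where "matroid_circuit n x C" "g = (\<Sum>i\<in>C. pconst (a C i) * (\<Prod>j\<in>C - {i}. py j))"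
  | i where "i \<le> n" "g = px i * py i - px 0 * py 0"
  using assms unfolding generators_def by blast

lemma generator_bihomogeneous:
  assumes "g \<in> generators"
  shows "bihomogeneous n g"
  using assms
proof (cases rule: generator_cases)
  case (linear C)
  have "bigraded n (0 + 1) (0 + 0) g"
    unfolding linear(2)
    by (intro bigraded_sum bigraded_mult bigraded_pconst bigraded_px circuit_properties(4)[OF linear(1)])
  then show ?thesis by (rule bihomogeneous_if_bigraded)
next
  case (cremona C)
  have "bigraded n (0 + 0) (0 + (card C - 1)) g"
    unfolding cremona(2)
  proof (intro bigraded_sum bigraded_mult bigraded_pconst)
    fix i assume "i \<in> C"
    then have "card (C - {i}) = card C - 1" by simp
    moreover have "bigraded n 0 (card (C - {i})) (\<Prod>j\<in>C - {i}. py j :: 'k bipoly)"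
      by (rule bigraded_prod_py) (use circuit_properties[OF cremona(1)] in auto)
    ultimately show "bigraded n 0 (card C - 1) (\<Prod>j\<in>C - {i}. py j :: 'k bipoly)" by simp
  qed
  then show ?thesis by (rule bihomogeneous_if_bigraded)
next
  case (product i)
  have "bigraded n (1 + 0) (0 + 1) g"
    unfolding product(2) using product(1)
    by (intro bigraded_diff bigraded_mult bigraded_px bigraded_py) auto
  then show ?thesis by (rule bihomogeneous_if_bigraded)
qed

lemma generator_vanishes:
  assumes "g \<in> generators"
  shows "g \<in> V"
proof -
  have "bieval g (z, w) = 0" if p: "(z, w) \<in> cremona_graph n x" for z w
  proof -
    obtain c where z: "z \<in> geom_space n x" "\<And>i. i \<le> n \<Longrightarrow> z i \<noteq> 0"
      and c: "c \<noteq> 0" "\<And>i. i \<le> n \<Longrightarrow> w i = c * inverse (z i)"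
      using p unfolding cremona_graph_def by blast
    have rel: "(\<Sum>i\<in>C. to_ac (a C i) * z i) = 0" if C: "matroid_circuit n x C" for C
    proof (rule geom_space_relation[OF _ _ z(1)])
      show "(\<Sum>i\<in>C. a C i * x i v) = 0" for v
        using circuit_coefficients[OF C] unfolding circuit_relation_def by blast
      show "C \<subseteq> {..n}" using circuit_properties(4)[OF C] by auto
    qed
    show ?thesis using assms
    proof (cases rule: generator_cases)
      case (linear C)
      then show ?thesis using rel by (simp add: coordinate_def)
    next
      case (cremona C)
      note C = circuit_properties[OF cremona(1)]
      have "(\<Prod>j\<in>C - {i}. w j) = (\<Prod>j\<in>C. w j) * (z i / c)" if i: "i \<in> C" for i
      proof -
        have "z i \<noteq> 0" "w i = c * inverse (z i)" using z(2) c(2) C(4)[OF i] by auto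
        then show ?thesis using c(1) by (simp add: prod.remove[OF C(1) i])
      qed
      then have "bieval g (z, w) = (\<Sum>i\<in>C. to_ac (a C i) * ((\<Prod>j\<in>C. w j) * (z i / c)))"
        unfolding cremona(2) by (simp add: coordinate_def)
      also have "\<dots> = ((\<Prod>j\<in>C. w j) / c) * (\<Sum>i\<in>C. to_ac (a C i) * z i)"
        by (simp add: sum_distrib_left mult_ac)
      finally show ?thesis using rel[OF cremona(1)] by simp
    next
      case (product i)
      then show ?thesis using z(2)[of i] z(2)[of 0] c(2)[of i] c(2)[of 0] by (simp add: coordinate_def)
    qed
  qed
  moreover have "Poly_Mapping.keys g \<subseteq> monomials n"
    using generator_bihomogeneous[OF assms] by (simp add: bihomogeneous_def)
  ultimately show ?thesis unfolding vanishing_ideal_def by auto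
qed

lemma generators_keys: "g \<in> generators \<Longrightarrow> Poly_Mapping.keys g \<subseteq> monomials n"
  using generator_bihomogeneous by (simp add: bihomogeneous_def)

lemma ideal_J: "poly_ideal n J" and generators_subset_J: "generators \<subseteq> J"
  unfolding J_def using genideal_poly(1,2)[of generators n] generators_keys by blast+

lemma J_subset_reciprocal_ideal: "J \<subseteq> reciprocal_ideal n x"
proof -
  let ?H = "{f. bihomogeneous n f \<and> f \<in> V}"
  have H: "\<And>h. h \<in> ?H \<Longrightarrow> Poly_Mapping.keys h \<subseteq> monomials n" by (simp add: vanishing_ideal_def)
  have "generators \<subseteq> ?H" using generator_bihomogeneous generator_vanishes by blast
  then have "generators \<subseteq> Idl\<^bsub>coord_ring n\<^esub> ?H" using genideal_poly(2)[of ?H, OF H] by blast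
  then show ?thesis unfolding J_def reciprocal_ideal_eq
    by (intro genideal_poly(3) generators_keys genideal_poly(1)[of ?H, OF H])
qed

lemma reciprocal_ideal_subset_V: "reciprocal_ideal n x \<subseteq> V"
  unfolding reciprocal_ideal_eq
  by (rule genideal_poly(3)) (auto simp: vanishing_ideal_def intro: poly_ideal_vanishing_ideal[unfolded vanishing_ideal_def])

text \<open>The support of a nontrivial relation contains a circuit, and a multiple of the relation of this
  circuit cancels one coefficient without enlarging the support.\<close>

lemma linear_relation_in_J:
  assumes "D \<subseteq> {..n}" "\<And>v. (\<Sum>i\<in>D. b i * x i v) = 0"
  shows "(\<Sum>i\<in>D. pconst (b i) * px i) \<in> J"
proof -
  have finD: "finite D" using assms(1) by (rule finite_subset) simp
  from assms(2) show ?thesis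
  proof (induction "card {i\<in>D. b i \<noteq> 0}" arbitrary: b rule: less_induct)
    case less
    let ?S = "{i\<in>D. b i \<noteq> 0}"
    have finS: "finite ?S" using finD by simp
    show ?case
    proof (cases "?S = {}")
      case True
      then have "(\<Sum>i\<in>D. pconst (b i) * px i) = 0" by (intro sum.neutral) (simp add: pconst_0)
      then show ?thesis using poly_ideal_zero[OF ideal_J] by simp
    next
      case False
      have "(\<Sum>i\<in>?S. b i * x i v) = 0" for v
      proof -
        have "(\<Sum>i\<in>?S. b i * x i v) = (\<Sum>i\<in>D. b i * x i v)"
          by (rule sum.mono_neutral_left) (use finD in auto)
        then show ?thesis using less.prems by simp
      qed
      then have "\<not> independent_forms x ?S" using False unfolding independent_forms_def by blast
      moreover have "?S \<subseteq> {..n}" using assms(1) by blast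
      ultimately obtain C where C: "C \<subseteq> ?S" "matroid_circuit n x C"
        by (metis (no_types, lifting) dependent_contains_circuit)
      note Cp = circuit_properties[OF C(2)]
      obtain k where k: "k \<in> C" using Cp(2) by blast
      have aC: "\<And>i. i \<in> C \<Longrightarrow> a C i \<noteq> 0" "\<And>v. (\<Sum>i\<in>C. a C i * x i v) = 0"
        using circuit_coefficients[OF C(2)] unfolding circuit_relation_def by blast+
      define r where "r = b k / a C k"
      define c where "c i = (if i \<in> C then r * a C i else 0)" for i
      define b' where "b' i = b i - c i" for i
      have CD: "C \<subseteq> D" using C(1) by blast
      have c_sum: "(\<Sum>i\<in>D. c i * x i v) = r * (\<Sum>i\<in>C. a C i * x i v)" for v
      proof -
        have "(\<Sum>i\<in>D. c i * x i v) = (\<Sum>i\<in>C. c i * x i v)"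
          by (rule sum.mono_neutral_right) (use finD CD in \<open>auto simp: c_def\<close>)
        then show ?thesis by (simp add: c_def sum_distrib_left mult.assoc)
      qed
      have c_poly: "(\<Sum>i\<in>D. pconst (c i) * px i) = pconst r * (\<Sum>i\<in>C. pconst (a C i) * px i)"
      proof -
        have "(\<Sum>i\<in>D. pconst (c i) * px i) = (\<Sum>i\<in>C. pconst (c i) * px i :: 'k bipoly)"
          by (rule sum.mono_neutral_right) (use finD CD in \<open>auto simp: c_def pconst_0\<close>)
        then show ?thesis by (simp add: c_def sum_distrib_left mult.assoc pconst_mult)
      qed
      have "(\<Sum>i\<in>D. b' i * x i v) = 0" for v
        using less.prems[of v] aC(2)[of v] c_sum[of v] by (simp add: b'_def left_diff_distrib sum_subtractf)
      moreover have "card {i\<in>D. b' i \<noteq> 0} < card ?S"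
      proof (rule psubset_card_mono[OF finS])
        have "b' k = 0" using k aC(1)[OF k] by (simp add: b'_def c_def r_def)
        moreover have "k \<in> ?S" using k C(1) by blast
        moreover have "{i\<in>D. b' i \<noteq> 0} \<subseteq> ?S" using C(1) by (auto simp: b'_def c_def)
        ultimately show "{i\<in>D. b' i \<noteq> 0} \<subset> ?S" by blast
      qed
      ultimately have b': "(\<Sum>i\<in>D. pconst (b' i) * px i) \<in> J" using less.hyps by blast
      have "(\<Sum>i\<in>C. pconst (a C i) * px i) \<in> generators" using C(2) unfolding generators_def by blast
      then have "pconst r * (\<Sum>i\<in>C. pconst (a C i) * px i) \<in> J"
        using generators_subset_J by (intro poly_ideal_mult[OF ideal_J keys_pconst]) blast
      with b' have "(\<Sum>i\<in>D. pconst (b' i) * px i) + (\<Sum>i\<in>D. pconst (c i) * px i) \<in> J"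
        unfolding c_poly by (rule poly_ideal_add[OF ideal_J])
      moreover have "pconst (b i) = pconst (b' i) + pconst (c i)" for i
        by (simp add: b'_def pconst_add[symmetric])
      ultimately show ?thesis by (simp add: distrib_right sum.distrib)
    qed
  qed
qed

lemma pterm_squarefree_YVar:
  "pterm (squarefree_monomial (YVar ` I)) = (\<Prod>i\<in>I. py i :: 'k bipoly)"
  by (simp add: pterm_squarefree_monomial prod.reindex inj_on_def)

lemma squarefree_monomial_insert:
  "finite A \<Longrightarrow> v \<notin> A \<Longrightarrow> squarefree_monomial (insert v A) = mvar v + squarefree_monomial A"
  by (simp add: squarefree_monomial_def)

lemma squarefree_monomial_in: "finite A \<Longrightarrow> A \<subseteq> bivars n \<Longrightarrow> squarefree_monomial A \<in> monomials n"
  by (simp add: monomials_iff keys_squarefree_monomial)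

lemma YVar_subset_bivars: "I \<subseteq> {..n} \<Longrightarrow> YVar ` I \<subseteq> bivars n"
  by (auto simp: bivars_def)

lemma mvar_in_monomials: "v \<in> bivars n \<Longrightarrow> mvar v \<in> monomials n"
  by (simp add: monomials_iff mvar_def)

text \<open>For a broken circuit, the term of the Cremona transformed circuit relation that omits the minimum
  of the circuit leads, because \<open>py i\<close> grows with \<open>i\<close>.

  In the second case, a linear relation for \<open>x j\<close> is multiplied by the variables \<open>py i\<close> with \<open>i \<in> I\<close>.  Its
  terms for later indices are smaller than the one for \<open>j\<close>.  The others have an index \<open>k \<in> I\<close>, and
  there \<open>px k * py k\<close> is replaced by \<open>px 0 * py 0\<close>; this makes them smaller, as \<open>py 0\<close> does not divide the
  leading term.  The degenerate case \<open>j \<in> I\<close> is covered, as \<open>j\<close> is then one of these \<open>k\<close>.\<close>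

lemma nonface_relation:
  assumes "A \<in> enbc_nonfaces"
  shows "\<exists>(D :: nat set) h b. finite D \<and>
    pterm (squarefree_monomial A) - (\<Sum>k\<in>D. pconst (b k) * pterm (h k)) \<in> J \<and>
    (\<forall>k\<in>D. (h k, squarefree_monomial A) \<in> T - Id \<and> mdegree (h k) = mdegree (squarefree_monomial A))"
  using assms
proof (cases rule: enbc_nonface_cases)
  case (broken C)
  note C = circuit_properties[OF broken(1)]
  let ?m = "Min C" and ?a = "a C"
  let ?h = "\<lambda>i. squarefree_monomial (YVar ` (C - {i}))"
  have Cn: "C \<subseteq> {..n}" using C(4) by auto
  have am: "?a ?m \<noteq> 0" using circuit_coefficients[OF broken(1)] C(3) unfolding circuit_relation_def by blast
  let ?D = "C - {?m}" and ?b = "\<lambda>i. - (inverse (?a ?m) * ?a i)"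
  have "(\<Sum>i\<in>C. pconst (?a i) * (\<Prod>j\<in>C - {i}. py j)) \<in> generators"
    using broken(1) unfolding generators_def by blast
  then have "pconst (inverse (?a ?m)) * (\<Sum>i\<in>C. pconst (?a i) * (\<Prod>j\<in>C - {i}. py j)) \<in> J"
    using generators_subset_J by (intro poly_ideal_mult[OF ideal_J keys_pconst]) blast
  also have "pconst (inverse (?a ?m)) * (\<Sum>i\<in>C. pconst (?a i) * (\<Prod>j\<in>C - {i}. py j))
      = (\<Sum>i\<in>C. pconst (inverse (?a ?m) * ?a i) * pterm (?h i))"
    by (simp add: sum_distrib_left pconst_mult pterm_squarefree_YVar mult.assoc)
  also have "\<dots> = pterm (?h ?m) + (\<Sum>i\<in>?D. pconst (inverse (?a ?m) * ?a i) * pterm (?h i))"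
    using am by (simp add: sum.remove[OF C(1,3)] pconst_1)
  also have "\<dots> = pterm (?h ?m) - (\<Sum>i\<in>?D. pconst (?b i) * pterm (?h i))"
    by (simp add: pconst_def single_uminus sum_negf)
  finally have "pterm (?h ?m) - (\<Sum>i\<in>?D. pconst (?b i) * pterm (?h i)) \<in> J" .
  moreover have "(?h i, ?h ?m) \<in> T - Id \<and> mdegree (?h i) = mdegree (?h ?m)" if i: "i \<in> ?D" for i
  proof
    let ?u = "squarefree_monomial (YVar ` (C - {i, ?m}))"
    have "YVar ` (C - {i}) = insert (YVar ?m) (YVar ` (C - {i, ?m}))" using C(3) i by auto
    then have hi: "?h i = mvar (YVar ?m) + ?u"
      by (simp only:) (rule squarefree_monomial_insert, use C(1) in auto)
    have "YVar ` (C - {?m}) = insert (YVar i) (YVar ` (C - {i, ?m}))" using i by auto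
    then have hm: "?h ?m = mvar (YVar i) + ?u"
      by (simp only:) (rule squarefree_monomial_insert, use C(1) in auto)
    have "?m < i" using i Min_le[OF C(1), of i] by auto
    then have "(mvar (YVar ?m), mvar (YVar i)) \<in> T - Id" using C(3,4) i by (intro y_order) auto
    moreover have "?u \<in> monomials n"
      by (intro squarefree_monomial_in YVar_subset_bivars) (use C(1) Cn in auto)
    ultimately show "(?h i, ?h ?m) \<in> T - Id" unfolding hi hm by (rule T_strict_add)
    show "mdegree (?h i) = mdegree (?h ?m)" unfolding hi hm by (simp add: mdegree_add mdegree_mvar)
  qed
  ultimately show ?thesis unfolding broken(2) using C(1)
    by (intro exI[of _ ?D] exI[of _ ?h] exI[of _ ?b]) simp
next
  case (spanned j I)
  have In: "I \<subseteq> {..n}" using spanned(2) by auto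
  then have finI: "finite I" by (rule finite_subset) simp
  let ?D = "after j \<union> I" and ?sq = "\<lambda>I. squarefree_monomial (YVar ` I)"
  \<comment> \<open>the terms below the leading one: those with \<open>k\<close> not after \<open>j\<close> have \<open>px k * py k\<close> replaced by \<open>px 0 * py 0\<close>\<close>
  let ?h = "\<lambda>k. if k \<in> after j then mvar (XVar k) + ?sq I else mvar (XVar 0) + mvar (YVar 0) + ?sq (I - {k})"
  let ?g = "squarefree_monomial A"
  have finD: "finite ?D" using finI finite_after by simp
  have Dn: "?D \<subseteq> {..n}" using In after_subset by blast
  have g: "?g = mvar (XVar j) + ?sq I"
    unfolding spanned(4) by (rule squarefree_monomial_insert) (use finI in auto)
  obtain b where b: "\<And>v. x j v = (\<Sum>k\<in>?D. b k * x k v)" using spanned(3) unfolding in_span_def by blast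
  have pY: "pterm (?sq I') = (\<Prod>i\<in>I'. py i :: 'k bipoly)" for I' by (rule pterm_squarefree_YVar)
  have keys_pY: "Poly_Mapping.keys (\<Prod>i\<in>I'. py i :: 'k bipoly) \<subseteq> monomials n" if "I' \<subseteq> I" for I'
    unfolding pY[symmetric] using that In finite_subset[OF that finI]
    by (simp, intro squarefree_monomial_in YVar_subset_bivars) auto
  \<comment> \<open>the coefficients of the linear relation that expresses \<open>x j\<close>; the index \<open>j\<close> may lie in \<open>I\<close>\<close>
  define c where "c i = (if i = j then 1 else 0) - (if i \<in> ?D then b i else 0)" for i
  have c_sum: "(\<Sum>i\<in>insert j ?D. \<phi> (c i) i) = \<phi> 1 j - (\<Sum>i\<in>?D. \<phi> (b i) i)"
    if \<phi>: "\<And>s t i. \<phi> (s - t) i = \<phi> s i - \<phi> t i" for \<phi> :: "'k \<Rightarrow> nat \<Rightarrow> 'r::ab_group_add"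
  proof -
    have \<phi>0: "\<phi> 0 i = 0" for i using \<phi>[of 0 0 i] by simp
    have "(\<Sum>i\<in>insert j ?D. \<phi> (c i) i) =
        (\<Sum>i\<in>insert j ?D. if i = j then \<phi> 1 i else 0) - (\<Sum>i\<in>insert j ?D. if i \<in> ?D then \<phi> (b i) i else 0)"
      unfolding sum_subtractf[symmetric] by (rule sum.cong[OF refl]) (simp add: c_def \<phi> \<phi>0)
    moreover have "(\<Sum>i\<in>insert j ?D. if i = j then \<phi> 1 i else 0) = \<phi> 1 j"
      using finD by simp
    moreover have "(\<Sum>i\<in>insert j ?D. if i \<in> ?D then \<phi> (b i) i else 0) = (\<Sum>i\<in>?D. \<phi> (b i) i)"
      by (rule sum.mono_neutral_cong_right) (use finD in auto)
    ultimately show ?thesis by simp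
  qed
  have "(\<Sum>i\<in>insert j ?D. c i * x i v) = 0" for v
    using c_sum[of "\<lambda>s i. s * x i v"] b[of v] by (simp add: left_diff_distrib)
  then have "(\<Sum>i\<in>insert j ?D. pconst (c i) * px i) \<in> J"
    using Dn spanned(1) by (intro linear_relation_in_J) auto
  also have "(\<Sum>i\<in>insert j ?D. pconst (c i) * px i) = pconst 1 * px j - (\<Sum>k\<in>?D. pconst (b k) * px k :: 'k bipoly)"
    by (rule c_sum) (simp add: pconst_def single_diff left_diff_distrib)
  finally have linear: "px j - (\<Sum>k\<in>?D. pconst (b k) * px k) \<in> J" by (simp add: pconst_1)
  have 1: "(\<Prod>i\<in>I. py i) * (px j - (\<Sum>k\<in>?D. pconst (b k) * px k)) \<in> J"
    by (rule poly_ideal_mult[OF ideal_J keys_pY linear]) simp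
  have 2: "pconst (b k) * (px k * (\<Prod>i\<in>I. py i) - pterm (?h k)) \<in> J" if k: "k \<in> ?D" for k
  proof (rule poly_ideal_mult[OF ideal_J keys_pconst], cases "k \<in> after j")
    case True
    then show "px k * (\<Prod>i\<in>I. py i) - pterm (?h k) \<in> J"
      using poly_ideal_zero[OF ideal_J] by (simp add: pterm_add pY pvar_def[symmetric])
  next
    case False
    then have kI: "k \<in> I" "1 \<le> k" "k \<le> n" using k spanned(2) by auto
    have "px k * py k - px 0 * py 0 \<in> generators" using kI unfolding generators_def by blast
    then have "(\<Prod>i\<in>I - {k}. py i) * (px k * py k - px 0 * py 0) \<in> J"
      using generators_subset_J by (intro poly_ideal_mult[OF ideal_J keys_pY]) auto
    also have "(\<Prod>i\<in>I - {k}. py i) * (px k * py k - px 0 * py 0) = px k * (\<Prod>i\<in>I. py i :: 'k bipoly) - pterm (?h k)"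
    proof -
      have "pterm (?h k) = px 0 * py 0 * (\<Prod>i\<in>I - {k}. py i :: 'k bipoly)"
        using False by (simp only: if_False pterm_add pY pvar_def)
      then show ?thesis by (simp add: prod.remove[OF finI kI(1)] algebra_simps)
    qed
    finally show "px k * (\<Prod>i\<in>I. py i) - pterm (?h k) \<in> J" .
  qed
  have "pterm ?g - (\<Sum>k\<in>?D. pconst (b k) * pterm (?h k)) =
      (\<Prod>i\<in>I. py i) * (px j - (\<Sum>k\<in>?D. pconst (b k) * px k))
      + (\<Sum>k\<in>?D. pconst (b k) * (px k * (\<Prod>i\<in>I. py i) - pterm (?h k)))"
    unfolding g pterm_add pY pvar_def[symmetric]
    by (simp add: right_diff_distrib sum_subtractf sum_distrib_left mult_ac pvar_def)
  moreover have "\<dots> \<in> J" by (rule poly_ideal_add[OF ideal_J 1 poly_ideal_sum[OF ideal_J 2]])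
  ultimately have "pterm ?g - (\<Sum>k\<in>?D. pconst (b k) * pterm (?h k)) \<in> J" by simp
  moreover have "(?h k, ?g) \<in> T - Id \<and> mdegree (?h k) = mdegree ?g" if k: "k \<in> ?D" for k
  proof (cases "k \<in> after j")
    case True
    then have "(mvar (XVar k), mvar (XVar j)) \<in> T - Id" using after_iff x_order by blast
    moreover have "?sq I \<in> monomials n" by (intro squarefree_monomial_in YVar_subset_bivars In) (use finI in simp)
    ultimately have "(mvar (XVar k) + ?sq I, mvar (XVar j) + ?sq I) \<in> T - Id" by (rule T_strict_add)
    then show ?thesis using True unfolding g by (simp add: mdegree_add mdegree_mvar)
  next
    case False
    then have kI: "k \<in> I" using k by blast
    let ?s = "mvar (XVar 0) + mvar (YVar 0) + ?sq (I - {k})"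
    have "?sq I = mvar (YVar k) + ?sq (I - {k})"
    proof -
      have "YVar ` I = insert (YVar k) (YVar ` (I - {k}))" using kI by auto
      then show ?thesis using squarefree_monomial_insert[of "YVar ` (I - {k})" "YVar k"] finI by auto
    qed
    then have deg: "mdegree ?s = mdegree ?g" unfolding g by (simp add: mdegree_add mdegree_mvar)
    have "XVar 0 \<in> bivars n" "YVar 0 \<in> bivars n" by (auto simp: bivars_def)
    moreover have "?sq (I - {k}) \<in> monomials n"
      by (intro squarefree_monomial_in YVar_subset_bivars) (use finI In in auto)
    ultimately have s: "?s \<in> monomials n" by (intro monomials_add mvar_in_monomials)
    have "?g \<in> monomials n" using finite_enbc_nonface[OF assms] by (intro squarefree_monomial_in)
    moreover have "1 \<le> Poly_Mapping.lookup ?s (YVar 0)" by (simp add: lookup_add lookup_mvar)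
    moreover have "YVar 0 \<notin> A" using spanned(2,4) by auto
    then have "\<not> 1 \<le> Poly_Mapping.lookup ?g (YVar 0)"
      using finite_enbc_nonface[OF assms] by (simp add: lookup_squarefree_monomial)
    ultimately have "(?s, ?g) \<in> T - Id" using s deg y0_order[of 1 ?s ?g] by blast
    then show ?thesis using False deg by simp
  qed
  ultimately show ?thesis using finD
    by (intro exI[of _ ?D] exI[of _ ?h] exI[of _ b]) blast
qed

definition reducible :: "monomial \<Rightarrow> bool" where
  "reducible m \<longleftrightarrow> (\<exists>A\<in>enbc_nonfaces. A \<subseteq> Poly_Mapping.keys m)"

lemma nonface_in: "A \<in> enbc_nonfaces \<Longrightarrow> squarefree_monomial A \<in> monomials n"
  using finite_enbc_nonface squarefree_monomial_in by blast

sublocale reduction: homogeneous_reduction n T J reducible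
proof (rule homogeneous_reduction.intro[OF monomial_order_axioms], rule homogeneous_reduction_axioms.intro)
  show "poly_ideal n J" by (rule ideal_J)
  fix m assume m: "m \<in> monomials n" and "reducible m"
  then obtain A where A: "A \<in> enbc_nonfaces" "A \<subseteq> Poly_Mapping.keys m" unfolding reducible_def by blast
  let ?g = "squarefree_monomial A" and ?u = "m - squarefree_monomial A"
  have mg: "m = ?g + ?u" by (rule squarefree_monomial_dvd) (use A finite_enbc_nonface in auto)
  have u: "?u \<in> monomials n" by (rule monomials_minus[OF m])
  obtain D :: "nat set" and h b where D: "finite D"
      "pterm ?g - (\<Sum>k\<in>D. pconst (b k) * pterm (h k)) \<in> J"
      "\<And>k. k \<in> D \<Longrightarrow> (h k, ?g) \<in> T - Id" "\<And>k. k \<in> D \<Longrightarrow> mdegree (h k) = mdegree ?g"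
    using nonface_relation[OF A(1)] by blast
  define f where "f = pterm m - (\<Sum>k\<in>D. pconst (b k) * pterm (h k + ?u))"
  have lower: "(h k + ?u, m) \<in> T - Id" if "k \<in> D" for k
    by (subst (2) mg) (rule T_strict_add[OF D(3)[OF that] u])
  have "pterm ?u * (pterm ?g - (\<Sum>k\<in>D. pconst (b k) * pterm (h k))) \<in> J"
    by (rule poly_ideal_mult[OF ideal_J _ D(2)]) (use u in simp)
  also have "pterm ?u * (pterm ?g - (\<Sum>k\<in>D. pconst (b k) * pterm (h k))) =
      pterm (?g + ?u) - (\<Sum>k\<in>D. pconst (b k) * pterm (h k + ?u))"
    by (simp add: pterm_add right_diff_distrib sum_distrib_left mult_ac)
  finally have "f \<in> J" unfolding f_def by (simp only: mg[symmetric])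
  moreover have "Poly_Mapping.lookup f m = 1" by (rule leading_form(1)[OF D(1) lower m f_def])
  moreover have "mdegree k = mdegree m \<and> (k, m) \<in> T" if k: "k \<in> Poly_Mapping.keys f" for k
  proof -
    have "mdegree (h k + ?u) = mdegree m" if "k \<in> D" for k
      by (subst (2) mg) (simp add: mdegree_add D(4)[OF that])
    then show ?thesis using k leading_form(2)[OF D(1) lower m f_def] lower T_order(2)[OF m] by auto
  qed
  ultimately show "\<exists>f\<in>J. Poly_Mapping.lookup f m = 1 \<and>
      (\<forall>h\<in>Poly_Mapping.keys f. mdegree h = mdegree m \<and> (h, m) \<in> T)" by blast
qed

lemma J_subset_V: "J \<subseteq> V"
  using J_subset_reciprocal_ideal reciprocal_ideal_subset_V by blast

text \<open>The remainder differs from \<open>f\<close> by an element of \<open>J\<close>, so it vanishes on the graph as well.\<close>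

lemma V_normal_form_zero:
  assumes f: "f \<in> V" and g: "f - g \<in> J" "\<And>s. s \<in> Poly_Mapping.keys g \<Longrightarrow> s \<in> monomials n \<and> \<not> reducible s"
  shows "g = 0"
proof (rule standard_polynomial_eq_0)
  have "f - (f - g) \<in> V"
    by (rule poly_ideal_diff[OF poly_ideal_vanishing_ideal f]) (use g(1) J_subset_V in blast)
  then show "g \<in> V" by simp
qed (use g(2) in \<open>auto simp: reducible_def\<close>)

lemma V_subset_J: "V \<subseteq> J"
proof
  fix f assume f: "f \<in> V"
  then have keys: "Poly_Mapping.keys f \<subseteq> monomials n" by (simp add: vanishing_ideal_def)
  obtain g where g: "f - g \<in> J" "\<And>s. s \<in> Poly_Mapping.keys g \<Longrightarrow> s \<in> monomials n \<and> \<not> reducible s"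
    using reduction.normal_form[OF keys] by blast
  then have "g = 0" by (rule V_normal_form_zero[OF f])
  then show "f \<in> J" using g(1) by simp
qed

lemma reciprocal_ideal_eq_J: "reciprocal_ideal n x = J"
  using J_subset_reciprocal_ideal reciprocal_ideal_subset_V V_subset_J by blast

lemma init_term_reducible:
  assumes "f \<in> V" "f \<noteq> 0"
  shows "reducible (init_term T f)"
proof (rule ccontr)
  assume nr: "\<not> reducible (init_term T f)"
  have keys: "Poly_Mapping.keys f \<subseteq> monomials n" using assms(1) by (simp add: vanishing_ideal_def)
  obtain g where g: "f - g \<in> J" "\<And>s. s \<in> Poly_Mapping.keys g \<Longrightarrow> s \<in> monomials n \<and> \<not> reducible s"
    "f \<noteq> 0 \<Longrightarrow> \<not> reducible (init_term T f) \<Longrightarrow> g \<noteq> 0"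
    using reduction.normal_form[OF keys] by blast
  have "g = 0" by (rule V_normal_form_zero[OF assms(1) g(1,2)])
  then show False using g(3) assms(2) nr by blast
qed

lemma init_ideal_eq:
  "init_ideal n T (reciprocal_ideal n x) =
     Idl\<^bsub>coord_ring n\<^esub> {pterm m | m. m \<in> squarefree_monomial ` enbc_nonfaces}"
proof -
  define M where "M = {init_term T f | f. f \<in> J \<and> f \<noteq> 0}"
  have "init_ideal n T (reciprocal_ideal n x) = Idl\<^bsub>coord_ring n\<^esub> {pterm m | m. m \<in> M}"
    unfolding init_ideal_def reciprocal_ideal_eq_J M_def by (rule arg_cong[of _ _ "genideal _"]) blast
  moreover have M: "M \<subseteq> monomials n"
  proof
    fix m assume "m \<in> M"
    then obtain f where "f \<in> J" "f \<noteq> 0" "m = init_term T f" unfolding M_def by blast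
    then show "m \<in> monomials n" using init_term_max(1)[of f] poly_ideal_subset[OF ideal_J] by blast
  qed
  moreover have N: "squarefree_monomial ` enbc_nonfaces \<subseteq> monomials n" using nonface_in by blast
  moreover have "\<exists>m'\<in>squarefree_monomial ` enbc_nonfaces. \<exists>u\<in>monomials n. m = m' + u" if m: "m \<in> M" for m
  proof -
    have "reducible m" using m init_term_reducible J_subset_V unfolding M_def by blast
    then obtain A where A: "A \<in> enbc_nonfaces" "A \<subseteq> Poly_Mapping.keys m" unfolding reducible_def by blast
    have "m - squarefree_monomial A \<in> monomials n" using m M monomials_minus by blast
    moreover have "m = squarefree_monomial A + (m - squarefree_monomial A)"
      by (rule squarefree_monomial_dvd) (use A finite_enbc_nonface in auto)
    ultimately show ?thesis using A(1) by blast
  qed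
  moreover have "\<exists>m'\<in>M. \<exists>u\<in>monomials n. m = m' + u" if "m \<in> squarefree_monomial ` enbc_nonfaces" for m
  proof -
    obtain A where A: "A \<in> enbc_nonfaces" "m = squarefree_monomial A" using \<open>m \<in> _\<close> by blast
    obtain D :: "nat set" and h b where D: "finite D"
        "pterm m - (\<Sum>k\<in>D. pconst (b k) * pterm (h k)) \<in> J" "\<And>k. k \<in> D \<Longrightarrow> (h k, m) \<in> T - Id"
      using nonface_relation[OF A(1)] A(2) by blast
    define f where "f = pterm m - (\<Sum>k\<in>D. pconst (b k) * pterm (h k))"
    have mM: "m \<in> monomials n" using A nonface_in by blast
    note lead = leading_form[OF D(1,3) mM f_def]
    have "f \<noteq> 0" using lead(1) by auto
    then have "m \<in> M" unfolding M_def using lead(3) D(2)[folded f_def] by blast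
    then show ?thesis by (intro bexI[of _ m] bexI[of _ 0]) (simp_all add: monomials_0)
  qed
  ultimately show ?thesis
    using genideal_pterm_eq[OF M N, where 'k = 'k] by simp
qed

lemma nonface_terms:
  "({pterm m | m. m \<in> squarefree_monomial ` enbc_nonfaces} :: 'k bipoly set) =
     {\<Prod>i\<in>B. py i | B. broken_circuit n x B}
     \<union> {px j * (\<Prod>i\<in>I. py i) | j I. j \<le> n \<and> I \<subseteq> {1..n} \<and>
          rk x (upset n P j \<union> I) = rk x ((upset n P j - {j}) \<union> I)}"
    (is "?L = ?R")
proof -
  have p: "pterm (squarefree_monomial (insert (XVar j) (YVar ` I))) = px j * (\<Prod>i\<in>I. py i :: 'k bipoly)"
    if "I \<subseteq> {1..n}" for j I
  proof -
    have "finite (YVar ` I)" using finite_subset[OF that] by simp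
    then have "squarefree_monomial (insert (XVar j) (YVar ` I)) = mvar (XVar j) + squarefree_monomial (YVar ` I)"
      by (rule squarefree_monomial_insert) auto
    then show ?thesis by (simp add: pterm_add pterm_squarefree_YVar pvar_def)
  qed
  have "?L = (\<lambda>A. pterm (squarefree_monomial A)) ` enbc_nonfaces" by auto
  also have "\<dots> = {pterm (squarefree_monomial (YVar ` B)) | B. broken_circuit n x B}
     \<union> {pterm (squarefree_monomial (insert (XVar j) (YVar ` I))) | j I. j \<le> n \<and> I \<subseteq> {1..n} \<and>
          rk x (upset n P j \<union> I) = rk x ((upset n P j - {j}) \<union> I)}"
    unfolding enbc_nonfaces_def by blast
  also have "\<dots> = ?R" unfolding pterm_squarefree_YVar using p by (metis (no_types, lifting))
  finally show ?thesis .
qed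

text \<open>Every nonface contains a member of \<open>enbc_nonfaces\<close>, and these are nonfaces themselves; so the
  generators of either ideal are multiples of generators of the other.\<close>

lemma stanley_reisner_eq:
  "stanley_reisner_ideal n (enbc_complex n x P) =
     (Idl\<^bsub>coord_ring n\<^esub> {pterm m | m. m \<in> squarefree_monomial ` enbc_nonfaces} :: 'k bipoly set)"
proof -
  define S where "S = {A. A \<subseteq> bivars n \<and> A \<notin> enbc_complex n x P}"
  have "stanley_reisner_ideal n (enbc_complex n x P) =
      (Idl\<^bsub>coord_ring n\<^esub> {pterm m | m. m \<in> squarefree_monomial ` S} :: 'k bipoly set)"
    unfolding stanley_reisner_ideal_def S_def pterm_squarefree_monomial[symmetric]
    by (rule arg_cong[of _ _ "genideal _"]) blast
  moreover have finS: "finite A" if "A \<in> S" for A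
    using that finite_subset[OF _ finite_bivars] unfolding S_def by blast
  then have SM: "squarefree_monomial ` S \<subseteq> monomials n"
    using squarefree_monomial_in unfolding S_def by blast
  moreover have N: "squarefree_monomial ` enbc_nonfaces \<subseteq> monomials n" using nonface_in by blast
  moreover have "enbc_nonfaces \<subseteq> S"
    unfolding S_def using finite_enbc_nonface(2) not_in_enbc_complex_iff by blast
  then have "\<exists>m'\<in>squarefree_monomial ` S. \<exists>u\<in>monomials n. m = m' + u"
    if "m \<in> squarefree_monomial ` enbc_nonfaces" for m
    using that by (intro bexI[of _ m] bexI[of _ 0]) (auto simp: monomials_0)
  moreover have "\<exists>m'\<in>squarefree_monomial ` enbc_nonfaces. \<exists>u\<in>monomials n. m = m' + u"
    if m: "m \<in> squarefree_monomial ` S" for m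
  proof -
    obtain A where A: "A \<in> S" "m = squarefree_monomial A" using m by blast
    then obtain B where B: "B \<in> enbc_nonfaces" "B \<subseteq> A"
      using not_in_enbc_complex_iff unfolding S_def by blast
    have "m = squarefree_monomial B + (m - squarefree_monomial B)"
      by (rule squarefree_monomial_dvd)
         (use A(2) B finite_enbc_nonface(1) keys_squarefree_monomial[OF finS[OF A(1)]] in auto)
    moreover have "m - squarefree_monomial B \<in> monomials n" using m SM monomials_minus by blast
    ultimately show ?thesis using B(1) by blast
  qed
  ultimately show ?thesis
    using genideal_pterm_eq[OF SM N, where 'k = 'k] by simp
qed

end


theorem theorem1:
  fixes scale :: "'k::field \<Rightarrow> 'v::ab_group_add \<Rightarrow> 'v"
    and x :: "nat \<Rightarrow> 'v \<Rightarrow> 'k"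
    and n r :: nat
    and a :: "nat set \<Rightarrow> nat \<Rightarrow> 'k"
    and P :: "nat rel"
    and T :: "monomial rel"
  assumes "vector_space scale"
    and "vector_space.dim scale (UNIV :: 'v set) = r + 1"
    and "\<And>i. i \<le> n \<Longrightarrow> Vector_Spaces.linear scale (*) (x i)"
    and "\<And>i. i \<le> n \<Longrightarrow> \<exists>v. x i v \<noteq> 0"
    and distinct_hyperplanes: "inj_on (\<lambda>i. {v. x i v = 0}) {..n}"
    and essential: "(\<Inter>i\<in>{..n}. {v. x i v = 0}) = {0}"
    and circuit_coefficients:
      "\<And>C. matroid_circuit n x C \<Longrightarrow> circuit_relation x C (a C)"
    and "linear_order_on {..n} P"
    and "term_order n T"
    and "\<And>i j. (i, j) \<in> P \<Longrightarrow> i \<noteq> j \<Longrightarrow> (mvar (XVar j), mvar (XVar i)) \<in> T - Id"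
    and "\<And>i j. i \<le> n \<Longrightarrow> j \<le> n \<Longrightarrow> i > j \<Longrightarrow> (mvar (YVar j), mvar (YVar i)) \<in> T - Id"
    and "\<And>b s t. \<lbrakk>b \<ge> 1; s \<in> monomials n; t \<in> monomials n; mdegree s = mdegree t;
           b \<le> Poly_Mapping.lookup s (YVar 0); \<not> b \<le> Poly_Mapping.lookup t (YVar 0)\<rbrakk> \<Longrightarrow> (s, t) \<in> T - Id"
  shows
    "reciprocal_ideal n x = Idl\<^bsub>coord_ring n\<^esub>
        ({\<Sum>i\<in>C. pconst (a C i) * px i | C. matroid_circuit n x C}
         \<union> {\<Sum>i\<in>C. pconst (a C i) * (\<Prod>j\<in>C - {i}. py j) | C. matroid_circuit n x C}
         \<union> {px i * py i - px 0 * py 0 | i. 1 \<le> i \<and> i \<le> n})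
     \<and> init_ideal n T (reciprocal_ideal n x) = Idl\<^bsub>coord_ring n\<^esub>
        ({\<Prod>i\<in>B. py i | B. broken_circuit n x B}
         \<union> {px j * (\<Prod>i\<in>I. py i) | j I. j \<le> n \<and> I \<subseteq> {1..n} \<and>
              rk x (upset n P j \<union> I) = rk x ((upset n P j - {j}) \<union> I)})
     \<and> init_ideal n T (reciprocal_ideal n x) = stanley_reisner_ideal n (enbc_complex n x P)"
proof -
  interpret reciprocal_arrangement scale x n P T a
    by (intro reciprocal_arrangement.intro ordered_forms.intro linear_forms.intro ordered_forms_axioms.intro
        monomial_order.intro reciprocal_arrangement_axioms.intro)
       (fact assms)+
  show ?thesis
    using reciprocal_ideal_eq_J init_ideal_eq stanley_reisner_eq
    unfolding J_def generators_def nonface_terms by simp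
qed

end
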